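(* Fix $z\in\mathbb{C}\setminus\{0\}$. For $\alpha>0$ define $$I(z,\alpha):=\frac{\sqrt{\pi}}{z}\alpha^{-\frac14}e^{\frac{z^2}{8}}\operatorname{erf}\left(\frac{z}{2}\right)+\frac{4}{z}\alpha^{\frac14}e^{-\frac{z^2}{8}}\int_{0}^{\infty}\frac{e^{-\alpha x^2}\sinh(\sqrt{\alpha}\, xz)}{e^{2\pi x}-1}\, dx.$$ Then, as $\alpha\to 0^+$, $$I(z,\alpha)\sim\frac{-2}{\sqrt{\pi}}\alpha^{-1/4}e^{z^2/8}\sum_{m=0}^{\infty}\left(\frac{-\alpha}{\pi^2}\right)^{m}\zeta(2m)\,\Gamma\left(m+\frac12\right){}_1F_1\left(m+\frac12;\frac32;\frac{-z^2}{4}\right),$$ that is, $$I(z,\alpha)\sim\frac{\sqrt{\pi}}{z}e^{z^2/8}\operatorname{erf}\left(\frac{z}{2}\right)\alpha^{-1/4}+\frac{e^{-z^2/8}}{6}\alpha^{3/4}+\frac{(z^2-6)e^{-z^2/8}}{360}\alpha^{7/4}+\frac{(60-20z^2+z^4)e^{-z^2/8}}{15120}\alpha^{11/4}+\cdots.$$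
   Context: $\operatorname{erf}(z)=\frac{2}{\sqrt{\pi}}\int_0^z e^{-t^2}\,dt$; $\zeta$ is the Riemann zeta function (so $\zeta(0)=-1/2$); ${}_1F_1(a;c;w)$ is Kummer's confluent hypergeometric function. The asymptotic expansion is meant in the Poincaré sense as $\alpha\to0^+$. *)

theory Defs
  imports "HOL-Complex_Analysis.Complex_Analysis" "HOL-Library.Landau_Symbols"
begin

definition erf :: "complex \<Rightarrow> complex" where
  "erf z = 2 / complex_of_real (sqrt pi) * contour_integral (linepath 0 z) (\<lambda>t. exp (- (t ^ 2)))"

(* The analytic continuation of the Dirichlet series to the plane minus its pole at 1.  By the
   identity theorem it is unique there; the value 0 at the pole is only a convention that makes
   the description determine a total function. *)
definition riemann_zeta :: "complex \<Rightarrow> complex" where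
  "riemann_zeta = (THE f. f holomorphic_on (- {1}) \<and>
     (\<forall>s. Re s > 1 \<longrightarrow> (\<lambda>n. 1 / of_nat (Suc n) powr s) sums f s) \<and> f 1 = 0)"

(* Meaningful when c is not a nonpositive integer; the series then converges for every w. *)
definition kummer_1F1 :: "complex \<Rightarrow> complex \<Rightarrow> complex \<Rightarrow> complex" where
  "kummer_1F1 a c w = eval_fps (fps_hypergeo [a] [c] 1) w"

definition I_fun :: "complex \<Rightarrow> real \<Rightarrow> complex" where
  "I_fun z \<alpha> =
     complex_of_real (sqrt pi) / z * complex_of_real (\<alpha> powr (- 1 / 4)) * exp (z ^ 2 / 8) * erf (z / 2)
     + 4 / z * complex_of_real (\<alpha> powr (1 / 4)) * exp (- (z ^ 2) / 8) *
       (LBINT x:{0<..}. complex_of_real (exp (- \<alpha> * x ^ 2))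
          * sinh (complex_of_real (sqrt \<alpha> * x) * z) / complex_of_real (exp (2 * pi * x) - 1))"

(* f has the Poincare expansion g 0 + g 1 + g 2 + ... along the filter F, with respect to the
   asymptotic scale \<phi>: every term g m is a constant multiple of \<phi> m, and each partial sum
   approximates f up to an error of smaller order than its last scale function. *)
definition poincare_expansion ::
  "'a filter \<Rightarrow> (nat \<Rightarrow> 'a \<Rightarrow> complex) \<Rightarrow> ('a \<Rightarrow> complex) \<Rightarrow> (nat \<Rightarrow> 'a \<Rightarrow> complex) \<Rightarrow> bool" where
  "poincare_expansion F \<phi> f g \<longleftrightarrow>
     (\<forall>m. \<phi> (Suc m) \<in> o[F](\<phi> m)) \<and>
     (\<forall>m. \<exists>c. \<forall>\<^sub>F x in F. g m x = c * \<phi> m x) \<and>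
     (\<forall>N. (\<lambda>x. f x - (\<Sum>m\<le>N. g m x)) \<in> o[F](\<phi> N))"

definition quarter_scale :: "nat \<Rightarrow> real \<Rightarrow> complex" where
  "quarter_scale m \<alpha> = complex_of_real (\<alpha> powr (real m - 1 / 4))"

end

theory Submission
  imports Defs "HOL-Probability.Distributions"
begin

text \<open>
  With \<open>u = sqrt \<alpha> x\<close> the integrand in \<open>I_fun\<close> is \<open>exp (- u\<^sup>2) sinh (u z)\<close>, an odd entire function of
  \<open>u\<close>, divided by \<open>exp (2 \<pi> x) - 1\<close>. Its Taylor remainder of order \<open>2 N + 1\<close> is bounded by
  \<open>C u ^ (2 N + 1)\<close> uniformly on the half-line, so integrating the Taylor series termwise gives the
  expansion, the moments being \<open>(2 j + 1)! \<zeta>(2 j + 2) / (2 \<pi>) ^ (2 j + 2)\<close>. The Taylor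
  coefficients are terminating hypergeometric polynomials, which Kummer's transformation (that is,
  the Chu--Vandermonde identity) turns into the stated confluent hypergeometric values; the leading term is
  the classical representation of the error function.

  Since \<open>riemann_zeta\<close> is defined by a description, the existence of the analytic continuation has to be
  shown as well, and it also yields \<open>\<zeta>(0) = - 1 / 2\<close>. The values of \<open>\<zeta>\<close> at 2, 4, 6 come from
  differentiating the reflection formula of the Digamma function at \<open>1 / 2\<close>.
\<close>

section \<open>Analytic continuation of the zeta function\<close>

text \<open>Fubini for double series: the product majorant makes the family summable over all pairs,
  so row sums and column sums add up to the same total. It serves to exchange a binomial series with
  the sum over the integers.\<close>

lemma sums_swap:
  fixes f :: "nat \<Rightarrow> nat \<Rightarrow> 'a :: banach"
  assumes b: "summable b" "\<And>k. b k \<ge> 0" and c: "summable c" "\<And>n. c n \<ge> 0"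
    and bound: "\<And>k n. norm (f k n) \<le> b k * c n"
    and r: "\<And>k. (\<lambda>n. f k n) sums r k" and t: "\<And>n. (\<lambda>k. f k n) sums t n" and S: "t sums S"
  shows "r sums S"
proof -
  have "(\<lambda>(k, n). b k * c n) summable_on UNIV \<times> UNIV"
  proof (rule summable_on_SigmaI)
    show "((\<lambda>n. case (k, n) of (k, n) \<Rightarrow> b k * c n) has_sum b k * suminf c) UNIV" for k
      using c by (auto intro!: has_sum_cmult_right sums_nonneg_imp_has_sum summable_sums)
    show "(\<lambda>k. b k * suminf c) summable_on UNIV"
      using b by (intro summable_on_cmult_left) (simp add: summable_on_UNIV_nonneg_real_iff)
  qed (use b c in auto)
  then have "(\<lambda>(k, n). f k n) abs_summable_on UNIV \<times> UNIV"
    by (rule Infinite_Sum.abs_summable_on_comparison_test') (use bound in auto)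
  then have *: "(\<lambda>(k, n). f k n) summable_on UNIV \<times> UNIV"
    by (rule abs_summable_summable)
  then obtain T where T: "((\<lambda>(k, n). f k n) has_sum T) (UNIV \<times> UNIV)"
    by (auto simp: summable_on_def)
  have row: "((\<lambda>n. f k n) has_sum r k) UNIV" for k
    by (rule norm_summable_imp_has_sum[OF summable_comparison_test[OF _ summable_mult[OF c(1), of "b k"]] r])
       (use bound in auto)
  have col: "((\<lambda>k. f k n) has_sum t n) UNIV" for n
    by (rule norm_summable_imp_has_sum[OF summable_comparison_test[OF _ summable_mult2[OF b(1), of "c n"]] t])
       (use bound in auto)
  have "(r has_sum T) UNIV"
    by (rule has_sum_SigmaD[OF T]) (use row in auto)
  moreover have "(t has_sum T) UNIV"
    by (rule has_sum_SigmaD[where f = "\<lambda>(n, k). f k n" and B = "\<lambda>_. UNIV"])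
       (use col T[THEN has_sum_swap[THEN iffD1]] in \<open>auto simp: case_prod_unfold\<close>)
  ultimately show ?thesis
    using S has_sum_imp_sums sums_unique2 by metis
qed

text \<open>Weierstrass M-test with a local majorant, obtained from termwise
  differentiation.\<close>

lemma holomorphic_on_suminf:
  assumes S: "open S" and hol: "\<And>n. f n holomorphic_on S"
    and bound: "\<And>x. x \<in> S \<Longrightarrow> \<exists>d h. 0 < d \<and> summable h \<and> (\<forall>n. \<forall>y\<in>ball x d \<inter> S. cmod (f n y) \<le> h n)"
  shows "(\<lambda>x. \<Sum>n. f n x) holomorphic_on S"
proof -
  have "\<exists>g g'. \<forall>x\<in>S. (\<lambda>n. f n x) sums g x \<and> (\<lambda>n. deriv (f n) x) sums g' x \<and> (g has_field_derivative g' x) (at x)"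
  proof (rule series_and_derivative_comparison_local[OF S])
    show "(f n has_field_derivative deriv (f n) x) (at x)" if "x \<in> S" for n x
      using hol[of n] S that holomorphic_derivI by blast
    show "\<exists>d h. 0 < d \<and> summable h \<and> (\<forall>\<^sub>F n in sequentially. \<forall>y\<in>ball x d \<inter> S. cmod (f n y) \<le> h n)"
      if x: "x \<in> S" for x
    proof -
      obtain d h where "0 < d" "summable h" "\<forall>n. \<forall>y\<in>ball x d \<inter> S. cmod (f n y) \<le> h n"
        using bound[OF x] by blast
      then show ?thesis
        by (intro exI[of _ d] exI[of _ h] conjI always_eventually)
    qed
  qed
  then obtain g g' where g: "\<And>x. x \<in> S \<Longrightarrow> (\<lambda>n. f n x) sums g x"
      "\<And>x. x \<in> S \<Longrightarrow> (g has_field_derivative g' x) (at x)"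
    by blast
  then have "g holomorphic_on S"
    using S holomorphic_on_open by blast
  then show ?thesis
    by (rule holomorphic_transform) (rule sums_unique[OF g(1)])
qed

section \<open>Growth of Pochhammer symbols against decay of the Dirichlet series\<close>

lemma norm_pochhammer_le:
  fixes a :: "'a :: real_normed_field"
  assumes "norm a \<le> R"
  shows "norm (pochhammer a k) \<le> pochhammer R k"
proof -
  have "norm (a + of_nat i) \<le> R + of_nat i" for i
    using norm_triangle_ineq[of a "of_nat i"] assms by simp
  then show ?thesis
    unfolding pochhammer_prod prod_norm[symmetric] by (intro prod_mono) auto
qed

lemma pochhammer_nonneg_real: "0 \<le> R \<Longrightarrow> 0 \<le> pochhammer (R :: real) k"
  unfolding pochhammer_prod by (intro prod_nonneg) auto

text \<open>This is the binomial series of \<open>(1 - 1 / 2) powr (- R)\<close>. The ratio 1/2 is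
  the largest of the ratios 1/n with n at least 2, so this one series majorizes all the expansions
  below.\<close>

lemma summable_pochhammer_half: "summable (\<lambda>k. pochhammer R k / fact k * (1 / 2) ^ k :: real)"
proof -
  have "(- R gchoose k) * (- 1 / 2) ^ k = pochhammer R k / fact k * (1 / 2) ^ k" for k
  proof -
    have "(- 1 / 2 :: real) ^ k = (- 1) ^ k * (1 / 2) ^ k"
      by (metis divide_inverse inverse_eq_divide power_mult_distrib)
    then show ?thesis
      by (simp add: gbinomial_pochhammer)
  qed
  then show ?thesis
    using gen_binomial_real[of "- 1 / 2" "- R"] by (simp only: sums_iff)
qed

text \<open>The term 1 of the Dirichlet series is left out so that the rest decays like
  \<open>2 powr (- s)\<close> to the right, which gives convergence of the binomial
  expansions.\<close>

definition zeta_minus_1 :: "complex \<Rightarrow> complex" where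
  "zeta_minus_1 s = (\<Sum>n. 1 / of_nat (n + 2) powr s)"

lemma norm_nat_powr: "norm (1 / of_nat (n + 2) powr s :: complex) = real (n + 2) powr (- Re s)"
  using norm_powr_real_powr[of "of_nat (n + 2)" s]
  by (simp add: norm_divide powr_minus_divide del: of_nat_add)

lemma summable_nat_powr: "\<sigma> > 1 \<Longrightarrow> summable (\<lambda>n. real (n + 2) powr - \<sigma>)"
  using summable_real_powr_iff[of "- \<sigma>"] by (subst summable_iff_shift) auto

lemma zeta_minus_1_sums: "Re s > 1 \<Longrightarrow> (\<lambda>n. 1 / of_nat (n + 2) powr s) sums zeta_minus_1 s"
  unfolding zeta_minus_1_def
  using summable_norm_cancel[of "\<lambda>n. 1 / of_nat (n + 2) powr s"] summable_nat_powr[of "Re s"]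
  by (simp only: norm_nat_powr summable_sums)

text \<open>Every unit of real part beyond 1 + \<delta> gains a factor 1/n, at most 1/2, in each
  term. The resulting geometric factor is what tames the Pochhammer symbols.\<close>

lemma norm_zeta_minus_1_le:
  assumes "\<delta> > 0" "Re s \<ge> 1 + \<delta> + real k"
  shows "norm (zeta_minus_1 s) \<le> (\<Sum>n. real (n + 2) powr - (1 + \<delta>)) * (1 / 2) ^ k"
proof -
  have *: "norm (1 / of_nat (n + 2) powr s :: complex) \<le> real (n + 2) powr - (1 + \<delta>) * (1 / 2) ^ k" for n
  proof -
    have "real (n + 2) powr - Re s \<le> real (n + 2) powr (- (1 + \<delta>) - real k)"
      using assms by (intro powr_mono) auto
    also have "\<dots> = real (n + 2) powr - (1 + \<delta>) * (1 / real (n + 2)) ^ k"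
      by (simp add: powr_diff powr_realpow power_divide)
    also have "\<dots> \<le> real (n + 2) powr - (1 + \<delta>) * (1 / 2) ^ k"
      by (intro mult_left_mono power_mono divide_left_mono) auto
    finally show ?thesis by (simp only: norm_nat_powr)
  qed
  have "summable (\<lambda>n. real (n + 2) powr - (1 + \<delta>))"
    using assms by (intro summable_nat_powr) auto
  then have "norm (zeta_minus_1 s) \<le> (\<Sum>n. real (n + 2) powr - (1 + \<delta>) * (1 / 2) ^ k)"
    unfolding zeta_minus_1_def by (intro norm_suminf_le * summable_mult2)
  also have "\<dots> = (\<Sum>n. real (n + 2) powr - (1 + \<delta>)) * (1 / 2) ^ k"
    by (rule suminf_mult2[symmetric]) fact
  finally show ?thesis .
qed

lemma holomorphic_zeta_minus_1: "zeta_minus_1 holomorphic_on {s. Re s > 1}"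
  unfolding zeta_minus_1_def[abs_def]
proof (rule holomorphic_on_suminf)
  show "(\<lambda>s. 1 / of_nat (n + 2) powr s) holomorphic_on {s. Re s > 1}" for n
    by (intro holomorphic_intros) auto
  fix x assume "x \<in> {s. Re s > 1}"
  then obtain \<delta> where \<delta>: "\<delta> > 0" "Re x > 1 + 2 * \<delta>"
    by (intro that[of "(Re x - 1) / 3"]) (auto simp: field_simps)
  have "cmod (1 / of_nat (n + 2) powr y) \<le> real (n + 2) powr - (1 + \<delta>)" if "y \<in> ball x \<delta>" for y n
  proof -
    have "\<bar>Re (x - y)\<bar> < \<delta>"
      using that abs_Re_le_cmod[of "x - y"] by (auto simp: dist_norm)
    then show ?thesis
      using \<delta> unfolding norm_nat_powr by (intro powr_mono) auto
  qed
  with \<delta> show "\<exists>d h. 0 < d \<and> summable h \<and>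
      (\<forall>n. \<forall>y\<in>ball x d \<inter> {s. Re s > 1}. cmod (1 / of_nat (n + 2) powr y) \<le> h n)"
    using summable_nat_powr[of "1 + \<delta>"]
    by (intro exI[of _ \<delta>] exI[of _ "\<lambda>n. real (n + 2) powr - (1 + \<delta>)"]) simp
qed (simp add: open_halfspace_Re_gt)

definition zeta0 :: "complex \<Rightarrow> complex" where
  "zeta0 s = (s - 1) * zeta_minus_1 s"

text \<open>
  Expanding \<open>(n - 1) powr (1 - s)\<close> by the binomial series around \<open>n\<close> and telescoping over
  \<open>n \<ge> 2\<close> shows that \<open>(s - 1) (\<zeta>(s) - 1)\<close> is a fixed point of the following operator. As the
  right-hand side only involves values at \<open>s + 1, s + 2, \<dots>\<close>, each application continues the
  function one unit further to the left; no poles appear, because the factor \<open>s + k - 1\<close> has been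
  absorbed into the Pochhammer symbol.
\<close>

definition zeta_step :: "(complex \<Rightarrow> complex) \<Rightarrow> complex \<Rightarrow> complex" where
  "zeta_step g s = 1 - (\<Sum>k. pochhammer (s - 1) (Suc k) / fact (k + 2) * g (s + of_nat (Suc k)))"

lemma zeta_step_zeta0:
  assumes s: "Re s > 1"
  shows "(\<lambda>k. pochhammer (s - 1) (Suc k) / fact (k + 2) * zeta0 (s + of_nat (Suc k))) sums (1 - zeta0 s)"
proof -
  define b where "b = (\<lambda>k. pochhammer (norm (s - 1)) (Suc k) / fact (Suc k) * (1 / 2) ^ k)"
  define c where "c = (\<lambda>n. real (n + 2) powr - Re s)"
  define f where "f = (\<lambda>k n. pochhammer (s - 1) (Suc k) / fact (Suc k) * (1 / of_nat (n + 2) powr (s + of_nat k)))"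
  have "(\<lambda>k. pochhammer (s - 1) (Suc k) / fact (Suc k) * zeta_minus_1 (s + of_nat k)) sums 1"
  proof (rule sums_swap[where f = f and b = b and c = c])
    have "summable (\<lambda>k. 2 * (pochhammer (norm (s - 1)) (Suc k) / fact (Suc k) * (1 / 2) ^ Suc k))"
      by (intro summable_mult) (subst summable_Suc_iff, rule summable_pochhammer_half)
    then show "summable b" by (simp add: b_def)
    show "b k \<ge> 0" for k by (simp add: b_def pochhammer_nonneg_real)
    show "summable c" unfolding c_def by (rule summable_nat_powr) fact
    show "c n \<ge> 0" for n by (simp add: c_def)
    show "norm (f k n) \<le> b k * c n" for k n
    proof -
      have "norm (f k n) = norm (pochhammer (s - 1) (Suc k)) / fact (Suc k) * (c n * (1 / real (n + 2)) ^ k)"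
        unfolding f_def norm_mult norm_nat_powr
        by (simp add: norm_divide c_def powr_diff powr_realpow power_divide del: fact_Suc)
      also have "\<dots> \<le> pochhammer (norm (s - 1)) (Suc k) / fact (Suc k) * (c n * (1 / 2) ^ k)"
        by (intro mult_mono divide_right_mono norm_pochhammer_le power_mono divide_left_mono)
           (auto simp: c_def pochhammer_nonneg_real)
      finally show ?thesis by (simp add: b_def mult_ac)
    qed
    show "f k sums (pochhammer (s - 1) (Suc k) / fact (Suc k) * zeta_minus_1 (s + of_nat k))" for k
      unfolding f_def by (intro sums_mult zeta_minus_1_sums) (use s in auto)
    \<comment> \<open>For fixed n the sum over k is the binomial series of (n + 1)^(1 - s) around n
      + 2 without its constant term. The differences telescope to 1 over n.\<close>
    show "(\<lambda>k. f k n) sums (of_nat (n + 1) powr (1 - s) - of_nat (n + 2) powr (1 - s))" for n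
    proof -
      have "(\<lambda>k. pochhammer (s - 1) k / fact k * of_nat (n + 2) powr (1 - s - of_nat k)) sums of_nat (n + 1) powr (1 - s)"
        using gen_binomial_complex'[of "- 1" "real (n + 2)" "1 - s"]
        by (simp add: gbinomial_pochhammer mult_ac flip: power_mult_distrib)
      then have "(\<lambda>k. pochhammer (s - 1) (Suc k) / fact (Suc k) * of_nat (n + 2) powr (1 - s - of_nat (Suc k)))
                   sums (of_nat (n + 1) powr (1 - s) - of_nat (n + 2) powr (1 - s))"
        by (subst sums_Suc_iff) simp
      moreover have "of_nat (n + 2) powr (1 - s - of_nat (Suc k)) = 1 / (of_nat (n + 2) powr (s + of_nat k) :: complex)" for k
        using powr_minus_divide[of "of_nat (n + 2)" "s + of_nat k"] by (simp add: algebra_simps)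
      ultimately show ?thesis by (simp only: f_def)
    qed
    have "(\<lambda>n. of_nat (Suc n) powr (1 - s)) \<longlonglongrightarrow> (0 :: complex)"
      by (rule LIMSEQ_Suc) (rule tendsto_neg_powr_complex_of_nat[OF filterlim_ident], use s in auto)
    from telescope_sums'[OF this]
    show "(\<lambda>n. of_nat (n + 1) powr (1 - s) - of_nat (n + 2) powr (1 - s)) sums (1 :: complex)"
      by (simp add: algebra_simps)
  qed
  \<comment> \<open>The term k = 0 is exactly \<open>zeta0 s\<close> and moves to the other side. In
    the remaining terms the last Pochhammer factor s + k turns \<open>zeta_minus_1\<close> at s + k
    + 1 into \<open>zeta0\<close>.\<close>
  then have "(\<lambda>k. pochhammer (s - 1) (Suc (Suc k)) / fact (Suc (Suc k)) * zeta_minus_1 (s + of_nat (Suc k))) sums (1 - zeta0 s)"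
    by (subst sums_Suc_iff) (simp add: zeta0_def)
  moreover have "pochhammer (s - 1) (Suc (Suc k)) / fact (Suc (Suc k)) * zeta_minus_1 (s + of_nat (Suc k)) =
      pochhammer (s - 1) (Suc k) / fact (k + 2) * zeta0 (s + of_nat (Suc k))" for k
    by (subst pochhammer_Suc) (simp add: zeta0_def algebra_simps)
  ultimately show ?thesis by (simp only:)
qed

lemma holomorphic_zeta0: "zeta0 holomorphic_on {s. Re s > 1}"
  unfolding zeta0_def[abs_def] by (intro holomorphic_intros holomorphic_zeta_minus_1)

lemma holomorphic_pochhammer [holomorphic_intros]:
  "f holomorphic_on A \<Longrightarrow> (\<lambda>s. pochhammer (f s) k) holomorphic_on A"
  unfolding pochhammer_prod by (intro holomorphic_intros)

text \<open>From index K on the arguments have real part above 1, where \<open>zeta0\<close> is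
  given by its series. There the factor \<open>(1 / 2) ^ k\<close> leaves a convergent binomial
  series as local majorant.\<close>

lemma zeta_tail_bound:
  assumes x: "Re x > - real K"
  shows "\<exists>d h. 0 < d \<and> summable h \<and> (\<forall>k. \<forall>y\<in>ball x d \<inter> {s. Re s > - real K}.
    cmod (pochhammer (y - 1) (Suc (k + K)) / fact (k + K + 2) * zeta0 (y + of_nat (Suc (k + K)))) \<le> h k)"
proof -
  \<comment> \<open>A third of the distance to the boundary: every point of the ball of radius
    \<delta> keeps a margin of \<delta>.\<close>
  obtain \<delta> where \<delta>: "\<delta> > 0" "Re x > - real K + 2 * \<delta>"
    by (intro that[of "(Re x + real K) / 3"]) (use x in \<open>auto simp: field_simps\<close>)
  define R where "R = norm (x - 1) + \<delta>"
  define C where "C = (\<Sum>n. real (n + 2) powr - (1 + \<delta>))"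
  \<comment> \<open>The power of 2 compensates for shifting the exponent of 1/2 from k to k + K + 2,
    which makes \<open>h\<close> a multiple of a tail of the binomial series.\<close>
  define h where "h = (\<lambda>k. 2 ^ (K + 2) * C * (pochhammer R (k + (K + 2)) / fact (k + (K + 2)) * (1 / 2) ^ (k + (K + 2))))"
  have "summable h"
    unfolding h_def by (intro summable_mult) (subst summable_iff_shift, rule summable_pochhammer_half)
  moreover have "cmod (pochhammer (y - 1) (Suc (k + K)) / fact (k + K + 2) * zeta0 (y + of_nat (Suc (k + K)))) \<le> h k"
    if y: "y \<in> ball x \<delta>" for y k
  proof -
    have "\<bar>Re (x - y)\<bar> < \<delta>"
      using y abs_Re_le_cmod[of "x - y"] by (auto simp: dist_norm)
    then have Re: "Re (y + of_nat (Suc (k + K))) \<ge> 1 + \<delta> + real k"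
      using \<delta> by auto
    have "norm (y - 1) \<le> R"
      using y norm_triangle_ineq[of "x - 1" "y - x"] by (auto simp: R_def dist_norm norm_minus_commute)
    then have p: "norm (pochhammer (y - 1) (k + K + 2)) \<le> pochhammer R (k + K + 2)"
      by (rule norm_pochhammer_le)
    have "pochhammer (y - 1) (Suc (k + K)) / fact (k + K + 2) * zeta0 (y + of_nat (Suc (k + K))) =
      pochhammer (y - 1) (k + K + 2) / fact (k + K + 2) * zeta_minus_1 (y + of_nat (Suc (k + K)))"
      using pochhammer_Suc[of "y - 1" "Suc (k + K)"] by (simp add: zeta0_def algebra_simps)
    also have "cmod \<dots> \<le> pochhammer R (k + K + 2) / fact (k + K + 2) * (C * (1 / 2) ^ k)"
      unfolding norm_mult norm_divide C_def
      by (intro mult_mono norm_zeta_minus_1_le)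
         (use p Re \<delta> in \<open>auto simp: R_def pochhammer_nonneg_real norm_fact intro!: divide_right_mono simp del: fact_Suc add_2_eq_Suc'\<close>)
    also have "\<dots> = h k"
      by (simp add: h_def power_add power_one_over ac_simps del: fact_Suc add_2_eq_Suc')
    finally show ?thesis .
  qed
  ultimately show ?thesis using \<delta>(1) by blast
qed

lemma zeta_step_split:
  assumes g: "\<And>s. Re s > 1 \<Longrightarrow> g s = zeta0 s" and s: "Re s > - real K"
  shows "(\<lambda>k. pochhammer (s - 1) (Suc k) / fact (k + 2) * g (s + of_nat (Suc k))) sums
    ((\<Sum>k<K. pochhammer (s - 1) (Suc k) / fact (k + 2) * g (s + of_nat (Suc k))) +
     (\<Sum>k. pochhammer (s - 1) (Suc (k + K)) / fact (k + K + 2) * zeta0 (s + of_nat (Suc (k + K)))))"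
proof -
  obtain d h where "0 < d" "summable h" "\<forall>k. \<forall>y\<in>ball s d \<inter> {s. Re s > - real K}.
    cmod (pochhammer (y - 1) (Suc (k + K)) / fact (k + K + 2) * zeta0 (y + of_nat (Suc (k + K)))) \<le> h k"
    using zeta_tail_bound[OF s] by blast
  then have "summable (\<lambda>k. pochhammer (s - 1) (Suc (k + K)) / fact (k + K + 2) * zeta0 (s + of_nat (Suc (k + K))))"
    using s by (intro summable_comparison_test[OF _ \<open>summable h\<close>]) auto
  moreover have "g (s + of_nat (Suc (k + K))) = zeta0 (s + of_nat (Suc (k + K)))" for k
    using s by (intro g) auto
  ultimately have "(\<lambda>k. pochhammer (s - 1) (Suc (k + K)) / fact (k + K + 2) * g (s + of_nat (Suc (k + K)))) sums
      (\<Sum>k. pochhammer (s - 1) (Suc (k + K)) / fact (k + K + 2) * zeta0 (s + of_nat (Suc (k + K))))"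
    by (simp only: summable_sums)
  then show ?thesis
    by (subst add.commute) (rule sums_iff_shift[THEN iffD1])
qed

text \<open>The first K terms evaluate \<open>g\<close> only where it is assumed holomorphic; all
  later ones see just \<open>zeta0\<close>, and the tail bound applies to them. So the half-plane
  grows by one unit.\<close>

lemma holomorphic_zeta_step:
  assumes g: "\<And>s. Re s > 1 \<Longrightarrow> g s = zeta0 s" and hol: "g holomorphic_on {s. Re s > 1 - real K}"
  shows "zeta_step g holomorphic_on {s. Re s > - real K}"
proof -
  have tail: "(\<lambda>s. \<Sum>k. pochhammer (s - 1) (Suc (k + K)) / fact (k + K + 2) * zeta0 (s + of_nat (Suc (k + K))))
      holomorphic_on {s. Re s > - real K}"
  proof (rule holomorphic_on_suminf)
    show "(\<lambda>s. pochhammer (s - 1) (Suc (k + K)) / fact (k + K + 2) * zeta0 (s + of_nat (Suc (k + K))))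
        holomorphic_on {s. Re s > - real K}" for k
      by (intro holomorphic_intros holomorphic_on_compose_gen[OF _ holomorphic_zeta0, unfolded o_def]) auto
  qed (use zeta_tail_bound in \<open>auto simp: open_halfspace_Re_gt\<close>)
  have "(\<lambda>s. 1 - ((\<Sum>k<K. pochhammer (s - 1) (Suc k) / fact (k + 2) * g (s + of_nat (Suc k))) +
     (\<Sum>k. pochhammer (s - 1) (Suc (k + K)) / fact (k + K + 2) * zeta0 (s + of_nat (Suc (k + K)))))) 
     holomorphic_on {s. Re s > - real K}"
    by (intro holomorphic_intros tail holomorphic_on_compose_gen[OF _ hol, unfolded o_def]) auto
  then show ?thesis
    by (rule holomorphic_transform) (use zeta_step_split[OF g] in \<open>auto simp: zeta_step_def sums_iff\<close>)
qed

section \<open>Gluing the iterates into an entire function\<close>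

definition zeta_iter :: "nat \<Rightarrow> complex \<Rightarrow> complex" where
  "zeta_iter K = (zeta_step ^^ K) zeta0"

text \<open>The operator looks at least one unit to the right, so agreement of two consecutive
  iterates on a half-plane passes to the half-plane one unit larger. The induction starts from the
  fixed-point equation of \<open>zeta0\<close>.\<close>

lemma zeta_iter_Suc: "Re s > 1 - real K \<Longrightarrow> zeta_iter (Suc K) s = zeta_iter K s"
proof (induction K arbitrary: s)
  case 0
  then show ?case
    using zeta_step_zeta0[of s] by (simp add: zeta_iter_def zeta_step_def sums_iff)
next
  case (Suc K)
  have "zeta_iter (Suc K) (s + of_nat (Suc k)) = zeta_iter K (s + of_nat (Suc k))" for k
    by (rule Suc.IH) (use Suc.prems in auto)
  then have "zeta_step (zeta_iter (Suc K)) s = zeta_step (zeta_iter K) s"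
    unfolding zeta_step_def by presburger
  then show ?case by (simp add: zeta_iter_def)
qed

lemma zeta_iter_le: "K \<le> L \<Longrightarrow> Re s > 1 - real K \<Longrightarrow> zeta_iter L s = zeta_iter K s"
  by (induction L rule: dec_induct) (auto simp: zeta_iter_Suc)

lemma zeta_iter_zeta0: "Re s > 1 \<Longrightarrow> zeta_iter K s = zeta0 s"
  using zeta_iter_le[of 0 K s] by (simp add: zeta_iter_def)

lemma holomorphic_zeta_iter: "zeta_iter K holomorphic_on {s. Re s > 1 - real K}"
proof (induction K)
  case 0
  show ?case using holomorphic_zeta0 by (simp add: zeta_iter_def)
next
  case (Suc K)
  show ?case using holomorphic_zeta_step[OF zeta_iter_zeta0 Suc.IH] by (simp add: zeta_iter_def)
qed

text \<open>The continuation of (s - 1)(zeta(s) - 1). The index is merely one large enough for s to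
  lie in the half-plane of that iterate; any other such index gives the same value.\<close>

definition zeta_entire :: "complex \<Rightarrow> complex" where
  "zeta_entire s = zeta_iter (nat \<lceil>2 - Re s\<rceil>) s"

lemma zeta_entire_eq:
  assumes "Re s > 1 - real K"
  shows "zeta_entire s = zeta_iter K s"
proof -
  let ?L = "nat \<lceil>2 - Re s\<rceil>"
  have L: "Re s > 1 - real ?L" by linarith
  show ?thesis
    using zeta_iter_le[of ?L K s] zeta_iter_le[of K ?L s] assms L
    unfolding zeta_entire_def by (metis nle_le)
qed

lemma holomorphic_zeta_entire: "zeta_entire holomorphic_on A"
proof -
  have "zeta_entire field_differentiable (at s)" for s
  proof -
    let ?K = "nat \<lceil>2 - Re s\<rceil>"
    have "zeta_entire holomorphic_on {s. Re s > 1 - real ?K}"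
      by (rule holomorphic_transform[OF holomorphic_zeta_iter]) (auto simp: zeta_entire_eq)
    moreover have "s \<in> {s. Re s > 1 - real ?K}" by simp linarith
    ultimately show ?thesis
      using holomorphic_on_imp_differentiable_at open_halfspace_Re_gt by blast
  qed
  then show ?thesis
    by (simp add: holomorphic_on_def field_differentiable_at_within)
qed

lemma zeta_entire_step: "zeta_entire s = zeta_step zeta_entire s"
proof -
  let ?K = "nat \<lceil>2 - Re s\<rceil>"
  have K: "Re s > 1 - real ?K" by linarith
  then have "zeta_entire s = zeta_step (zeta_iter ?K) s"
    using zeta_entire_eq[of "Suc ?K" s] by (simp add: zeta_iter_def)
  moreover have "zeta_entire (s + of_nat (Suc k)) = zeta_iter ?K (s + of_nat (Suc k))" for k
    using K by (intro zeta_entire_eq) (simp; linarith)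
  ultimately show ?thesis
    unfolding zeta_step_def by presburger
qed

lemma zeta_entire_1: "zeta_entire 1 = 1"
  by (subst zeta_entire_step) (simp add: zeta_step_def pochhammer_0_left)

text \<open>At s = 0 the Pochhammer symbols start at -1 and vanish from length 2 on, so the
  fixed-point series reduces to its first term, -1/2 times the value at 1.\<close>

lemma zeta_entire_0: "zeta_entire 0 = 3 / 2"
proof -
  have "pochhammer (- 1 :: complex) (Suc k) = 0" if "k > 0" for k
    using that by (subst pochhammer_eq_0_iff) (auto intro: exI[of _ 1])
  then have "(\<Sum>k. pochhammer (- 1 :: complex) (Suc k) / fact (k + 2) * zeta_entire (of_nat (Suc k))) =
      (\<Sum>k\<in>{0}. pochhammer (- 1 :: complex) (Suc k) / fact (k + 2) * zeta_entire (of_nat (Suc k)))"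
    by (intro suminf_finite) auto
  then show ?thesis
    by (subst zeta_entire_step) (simp add: zeta_step_def zeta_entire_1)
qed

lemma zeta_series_entire:
  assumes "Re s > 1"
  shows "(\<lambda>n. 1 / of_nat (Suc n) powr s) sums (1 + zeta_entire s / (s - 1))"
proof -
  have "s \<noteq> 1" using assms by auto
  then have "zeta_entire s / (s - 1) = zeta_minus_1 s"
    using zeta_entire_eq[of 0 s] assms by (simp add: zeta_iter_def zeta0_def)
  then have "(\<lambda>n. 1 / of_nat (Suc (Suc n)) powr s) sums (zeta_entire s / (s - 1))"
    using zeta_minus_1_sums[OF assms] by simp
  then show ?thesis
    by (subst (asm) sums_Suc_iff) (simp add: add.commute)
qed

text \<open>The identity theorem on the connected punctured plane gives uniqueness away from 1, and
  the convention fixes the value at 1.\<close>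

lemma riemann_zeta_characterization:
  assumes f: "f holomorphic_on - {1}" "\<And>s. Re s > 1 \<Longrightarrow> (\<lambda>n. 1 / of_nat (Suc n) powr s) sums f s" "f 1 = 0"
  shows "riemann_zeta = f"
  unfolding riemann_zeta_def
proof (rule the_equality)
  fix g assume g: "g holomorphic_on - {1} \<and>
     (\<forall>s. Re s > 1 \<longrightarrow> (\<lambda>n. 1 / of_nat (Suc n) powr s) sums g s) \<and> g 1 = 0"
  have "g s = f s" if "s \<noteq> 1" for s
  proof (rule analytic_continuation_open[of "{s. Re s > 1}" "- {1}" g f])
    have "2 \<in> {s. 1 < Re s}" by simp
    then show "{s. 1 < Re s} \<noteq> {}" by blast
    show "connected (- {1 :: complex})" by (rule connected_punctured_universe) simp
    show "g z = f z" if "z \<in> {s. Re s > 1}" for z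
      using that f(2) g sums_unique2 by blast
  qed (use f g that in \<open>auto simp: open_halfspace_Re_gt\<close>)
  then show "g = f" using f(3) g by (metis ext)
qed (use f in auto)

lemma riemann_zeta_eq:
  "riemann_zeta s = (if s = 1 then 0 else 1 + zeta_entire s / (s - 1))"
proof -
  have "riemann_zeta = (\<lambda>s. if s = 1 then 0 else 1 + zeta_entire s / (s - 1))"
  proof (rule riemann_zeta_characterization)
    have "(\<lambda>s. 1 + zeta_entire s / (s - 1)) holomorphic_on - {1}"
      by (intro holomorphic_intros holomorphic_zeta_entire) auto
    then show "(\<lambda>s. if s = 1 then 0 else 1 + zeta_entire s / (s - 1)) holomorphic_on - {1}"
      by (rule holomorphic_transform) auto
    show "(\<lambda>n. 1 / of_nat (Suc n) powr s) sums (if s = 1 then 0 else 1 + zeta_entire s / (s - 1))"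
      if "Re s > 1" for s
      using zeta_series_entire[OF that] that by auto
  qed simp
  then show ?thesis by metis
qed

lemma riemann_zeta_0: "riemann_zeta 0 = - 1 / 2"
  by (simp add: riemann_zeta_eq zeta_entire_0)

lemma riemann_zeta_sums: "Re s > 1 \<Longrightarrow> (\<lambda>n. 1 / of_nat (Suc n) powr s) sums riemann_zeta s"
  using zeta_series_entire[of s] by (auto simp: riemann_zeta_eq)

section \<open>Special values of the zeta function\<close>

text \<open>Both sides of Gamma(y) Gamma(1 - y) = pi / sin(pi y) are differentiated, and the common
  nonzero factor is cancelled.\<close>

lemma Digamma_reflection:
  fixes x :: real
  assumes x: "0 < x" "x < 1"
  shows "Polygamma 0 x - Polygamma 0 (1 - x) = - pi * cot (pi * x)"
proof -
  have nonint: "y \<notin> \<int>\<^sub>\<le>\<^sub>0" if "y > 0" for y :: real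
    using that by (auto elim!: nonpos_Ints_cases)
  have sin: "sin (pi * y) > 0" if "0 < y" "y < 1" for y
    using that by (intro sin_gt_zero) auto
  have eq: "Gamma y * Gamma (1 - y) = pi / sin (pi * y)" for y :: real
  proof -
    have "complex_of_real (Gamma y * Gamma (1 - y)) = of_real (pi / sin (pi * y))"
      using Gamma_reflection_complex[of "of_real y"]
      by (simp add: Gamma_complex_of_real[symmetric] flip: sin_of_real)
    then show ?thesis by (simp only: of_real_eq_iff)
  qed
  have "((\<lambda>y. Gamma y * Gamma (1 - y)) has_field_derivative
      Gamma x * Gamma (1 - x) * (Polygamma 0 x - Polygamma 0 (1 - x))) (at x)"
    using nonint[of x] nonint[of "1 - x"] x
    by (auto intro!: derivative_eq_intros simp: algebra_simps)
  then have "((\<lambda>y. pi / sin (pi * y)) has_field_derivative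
      pi / sin (pi * x) * (Polygamma 0 x - Polygamma 0 (1 - x))) (at x)"
    by (simp only: eq)
  moreover have "((\<lambda>y. pi / sin (pi * y)) has_field_derivative
      pi / sin (pi * x) * (- pi * cot (pi * x))) (at x)"
    using sin[OF x] by (auto intro!: derivative_eq_intros simp: cot_def field_simps power2_eq_square)
  ultimately have "pi / sin (pi * x) * (Polygamma 0 x - Polygamma 0 (1 - x)) = pi / sin (pi * x) * (- pi * cot (pi * x))"
    by (rule DERIV_unique)
  moreover have "pi / sin (pi * x) \<noteq> 0" using sin[OF x] by simp
  ultimately show ?thesis by (simp only: mult_cancel_left) simp
qed

lemma DERIV_eq_on_unit_interval:
  fixes f g :: "real \<Rightarrow> real"
  assumes eq: "\<And>x. 0 < x \<Longrightarrow> x < 1 \<Longrightarrow> f x = g x" and x: "0 < x" "x < 1"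
    and "(f has_field_derivative f') (at x)" "(g has_field_derivative g') (at x)"
  shows "f' = g'"
proof -
  have "(g has_field_derivative f') (at x)"
    by (rule has_field_derivative_transform_within_open[of f _ _ "{0<..<1}"]) (use assms in auto)
  then show ?thesis using assms(5) DERIV_unique by blast
qed

text \<open>The derivative is written as a polynomial in the cotangent, so that repeated
  differentiation stays within such polynomials.\<close>

lemma has_field_derivative_cot_pi:
  assumes "0 < x" "x < 1"
  shows "((\<lambda>x. cot (pi * x)) has_field_derivative - pi * (1 + cot (pi * x) ^ 2)) (at x)"
proof -
  have sin: "sin (pi * x) > 0" using assms by (intro sin_gt_zero) auto
  have "((\<lambda>x. cot (pi * x)) has_field_derivative - pi / sin (pi * x) ^ 2) (at x)"
    using sin
    by (intro DERIV_cong[OF DERIV_chain2[OF DERIV_cot, of "(*) pi"] ])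
       (auto intro!: derivative_eq_intros simp: divide_inverse)
  moreover have "1 + cot (pi * x) ^ 2 = 1 / sin (pi * x) ^ 2"
    using sin sin_cos_squared_add[of "pi * x"] by (simp add: cot_def power_divide field_simps)
  ultimately show ?thesis by (simp add: divide_inverse)
qed

text \<open>One differentiation of a reflection formula: the inner derivative of 1 - x flips the
  sign, and the chain rule maps p to -pi (1 + X^2) p'.\<close>

lemma Polygamma_reflection_Suc:
  assumes refl: "\<And>x. 0 < x \<Longrightarrow> x < 1 \<Longrightarrow> Polygamma n x + s * Polygamma n (1 - x) = poly p (cot (pi * x))"
    and x: "0 < x" "x < (1 :: real)"
  shows "Polygamma (Suc n) x + (- s) * Polygamma (Suc n) (1 - x) =
    poly (smult (- pi) ([:1, 0, 1:] * pderiv p)) (cot (pi * x))"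
proof (rule DERIV_eq_on_unit_interval[OF refl x])
  have "y \<notin> \<int>\<^sub>\<le>\<^sub>0" if "y > 0" for y :: real
    using that by (auto elim!: nonpos_Ints_cases)
  from this[of x] this[of "1 - x"] x
  show "((\<lambda>x. Polygamma n x + s * Polygamma n (1 - x)) has_field_derivative
      Polygamma (Suc n) x + (- s) * Polygamma (Suc n) (1 - x)) (at x)"
    by (auto intro!: derivative_eq_intros)
  show "((\<lambda>x. poly p (cot (pi * x))) has_field_derivative
      poly (smult (- pi) ([:1, 0, 1:] * pderiv p)) (cot (pi * x))) (at x)"
    by (rule DERIV_cong[OF DERIV_chain2[OF poly_DERIV has_field_derivative_cot_pi[OF x]]])
       (simp add: power2_eq_square algebra_simps)
qed

lemma Polygamma_half:
  "Polygamma 1 (1 / 2) = pi ^ 2 / 2" "Polygamma 3 (1 / 2) = pi ^ 4" "Polygamma 5 (1 / 2) = 8 * pi ^ 6"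
proof -
  have half: "cot (pi / 2) = 0" by (simp add: cot_def)
  \<comment> \<open>The n-fold derivative of the reflection formula. For odd n the sign is plus, so
    at x = 1/2 the left side is twice the wanted value, while cot(pi/2) = 0 leaves the constant
    coefficient of \<open>p n\<close>.\<close>
  define p where "p = (\<lambda>n. ((\<lambda>p. smult (- pi) ([:1, 0, 1:] * pderiv p)) ^^ n) [:0, - pi:])"
  have "Polygamma n x + (- ((- 1) ^ n)) * Polygamma n (1 - x) = poly (p n) (cot (pi * x))"
    if "0 < x" "x < 1" for n and x :: real
    using that
  proof (induction n arbitrary: x)
    case 0
    then show ?case using Digamma_reflection[of x] by (simp add: p_def)
  next
    case (Suc n)
    show ?case
      using Polygamma_reflection_Suc[OF Suc.IH Suc.prems] by (simp add: p_def)
  qed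
  from this[of "1 / 2" 1] this[of "1 / 2" 3] this[of "1 / 2" 5] half
  show "Polygamma 1 (1 / 2) = pi ^ 2 / 2" "Polygamma 3 (1 / 2) = pi ^ 4" "Polygamma 5 (1 / 2) = 8 * pi ^ 6"
    by (simp_all add: p_def eval_nat_numeral pderiv_pCons algebra_simps)
qed

text \<open>The polygamma series at 1/2 runs over powers of k + 1/2; scaling by 2 gives the odd
  integers. Oddness of n makes the sign in that series positive.\<close>

lemma sums_inverse_odd_powers:
  assumes "odd n"
  shows "(\<lambda>k. 1 / real (2 * k + 1) ^ Suc n) sums (Polygamma n (1 / 2) / (fact n * 2 ^ Suc n))"
proof -
  have "(\<lambda>k. inverse ((1 / 2 + real k) ^ Suc n)) sums (Polygamma n (1 / 2) / fact n)"
    using Polygamma_LIMSEQ[of "1 / 2 :: real" n] assms odd_pos[of n] by simp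
  from sums_divide[OF this, of "2 ^ Suc n"]
  have "(\<lambda>k. inverse ((1 / 2 + real k) ^ Suc n) / 2 ^ Suc n) sums (Polygamma n (1 / 2) / (fact n * 2 ^ Suc n))"
    by (simp only: divide_divide_eq_left)
  moreover have "inverse ((1 / 2 + real k) ^ Suc n) / 2 ^ Suc n = 1 / real (2 * k + 1) ^ Suc n" for k
  proof -
    have "inverse ((1 / 2 + real k) ^ Suc n) / 2 ^ Suc n = 1 / ((1 / 2 + real k) * 2) ^ Suc n"
      unfolding power_mult_distrib by (simp only: divide_inverse inverse_mult_distrib mult_1)
    also have "(1 / 2 + real k) * 2 = real (2 * k + 1)" by simp
    finally show ?thesis .
  qed
  ultimately show ?thesis by simp
qed

text \<open>Terms are grouped in consecutive pairs; the even integers contribute the whole series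
  again, scaled by 1/2^p.\<close>

lemma sums_all_from_odd:
  fixes Z L :: real
  assumes Z: "(\<lambda>n. 1 / real (Suc n) ^ p) sums Z" and L: "(\<lambda>k. 1 / real (2 * k + 1) ^ p) sums L"
  shows "Z = L + Z / 2 ^ p"
proof -
  have "(\<lambda>k. 1 / real (2 * k + 1) ^ p + 1 / real (Suc k) ^ p / 2 ^ p) sums (L + Z / 2 ^ p)"
    by (intro sums_add L sums_divide Z)
  moreover have "(\<Sum>n\<in>{k * 2..<k * 2 + 2}. 1 / real (Suc n) ^ p) =
      1 / real (2 * k + 1) ^ p + 1 / real (Suc k) ^ p / 2 ^ p" for k
  proof -
    have "real (Suc (2 * k + 1)) = real (Suc k) * 2" by simp
    then have "1 / real (Suc (2 * k + 1)) ^ p = 1 / real (Suc k) ^ p / 2 ^ p"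
      by (simp only: power_mult_distrib divide_divide_eq_left)
    moreover have "{k * 2..<k * 2 + 2} = {2 * k, 2 * k + 1}" by auto
    ultimately show ?thesis by (simp add: add.commute)
  qed
  ultimately show ?thesis
    using sums_group[OF Z, of 2] sums_unique2 by fastforce
qed

definition zeta_nat :: "nat \<Rightarrow> real" where
  "zeta_nat p = (\<Sum>n. 1 / real (Suc n) ^ p)"

lemma zeta_nat_sums:
  assumes "p \<ge> 2"
  shows "(\<lambda>n. 1 / real (Suc n) ^ p) sums zeta_nat p"
proof -
  have "summable (\<lambda>n. 1 / real (Suc n) ^ p)"
    using inverse_power_summable[OF assms, where 'a = real]
    by (subst summable_Suc_iff) (simp add: inverse_eq_divide)
  then show ?thesis unfolding zeta_nat_def by (rule summable_sums)
qed

lemma riemann_zeta_of_nat: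
  assumes "p \<ge> 2"
  shows "riemann_zeta (of_nat p) = of_real (zeta_nat p)"
proof -
  have "(\<lambda>n. 1 / of_nat (Suc n) powr (of_nat p)) sums riemann_zeta (of_nat p)"
    using assms by (intro riemann_zeta_sums) auto
  moreover have "1 / of_nat (Suc n) powr (of_nat p) = complex_of_real (1 / real (Suc n) ^ p)" for n
    by (simp add: powr_nat' del: of_nat_Suc)
  ultimately show ?thesis
    using sums_of_real[OF zeta_nat_sums[OF assms], where 'a = complex] sums_unique2 by fastforce
qed

lemma zeta_nat_even:
  "zeta_nat 2 = pi ^ 2 / 6" "zeta_nat 4 = pi ^ 4 / 90" "zeta_nat 6 = pi ^ 6 / 945"
proof -
  have fact: "fact 3 = (6 :: real)" "fact 5 = (120 :: real)"
    by (simp_all add: fact_numeral)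
  have "zeta_nat (Suc n) = Polygamma n (1 / 2) / (fact n * 2 ^ Suc n) + zeta_nat (Suc n) / 2 ^ Suc n" if "odd n" for n
    by (rule sums_all_from_odd[OF zeta_nat_sums sums_inverse_odd_powers]) (use that in \<open>auto elim: oddE\<close>)
  from this[of 1] this[of 3] this[of 5]
  show "zeta_nat 2 = pi ^ 2 / 6" "zeta_nat 4 = pi ^ 4 / 90" "zeta_nat 6 = pi ^ 6 / 945"
    by (simp_all add: Polygamma_half Polygamma_half(1)[unfolded One_nat_def] fact numeral_2_eq_2[symmetric])
qed

section \<open>Confluent hypergeometric functions\<close>

lemma pochhammer_minus_of_nat:
  assumes "k \<le> n"
  shows "pochhammer (- of_nat n) k = (- 1) ^ k * fact n / (fact (n - k) :: 'a :: field_char_0)"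
proof -
  have "of_nat (n choose k) = (- 1) ^ k * pochhammer (- of_nat n) k / (fact k :: 'a)"
    by (simp add: binomial_gbinomial gbinomial_pochhammer)
  then have "(- 1) ^ k * pochhammer (- of_nat n) k = fact k * (of_nat (n choose k) :: 'a)"
    by simp
  also have "\<dots> = fact n / fact (n - k)"
    using binomial_fact[OF assms, where 'a = 'a] by simp
  finally have "(- 1) ^ k * ((- 1) ^ k * pochhammer (- of_nat n) k) = (- 1) ^ k * (fact n / fact (n - k) :: 'a)"
    by (rule arg_cong)
  then show ?thesis by (simp add: mult.assoc[symmetric] flip: power_mult_distrib)
qed

text \<open>Comparing coefficients of degree n and multiplying by n! leaves precisely the
  Chu-Vandermonde identity.\<close>

lemma kummer_transformation_fps:
  fixes a c :: "'a :: field_char_0"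
  assumes c: "\<And>i. c \<noteq> - of_nat i"
  shows "fps_hypergeo [c - a] [c] 1 = fps_hypergeo [a] [c] (- 1) * fps_exp 1"
proof (rule fps_ext)
  fix n
  have "fact n * (fps_hypergeo [a] [c] (- 1) * fps_exp 1) $ n =
      (\<Sum>k=0..n. pochhammer a k * pochhammer (- of_nat n) k / (of_nat (fact k) * pochhammer c k))"
    unfolding fps_mult_nth sum_distrib_left by (intro sum.cong) (simp_all add: pochhammer_minus_of_nat mult_ac)
  also have "\<dots> = pochhammer (c - a) n / pochhammer c n"
    using Vandermonde_pochhammer[of n c a] c by blast
  finally have *: "fact n * (fps_hypergeo [a] [c] (- 1) * fps_exp 1) $ n = pochhammer (c - a) n / pochhammer c n" .
  have "fps_hypergeo [c - a] [c] 1 $ n = (pochhammer (c - a) n / pochhammer c n) / fact n"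
    by simp
  then show "fps_hypergeo [c - a] [c] 1 $ n = (fps_hypergeo [a] [c] (- 1) * fps_exp 1) $ n"
    unfolding *[symmetric] by (simp only: nonzero_mult_div_cancel_left[OF fact_nonzero])
qed

lemma three_halves_not_nonpos: "(3 / 2 :: complex) \<noteq> - of_nat i"
proof
  assume "(3 / 2 :: complex) = - of_nat i"
  then have "Re (3 / 2) = Re (- of_nat i)" by (rule arg_cong)
  then show False by simp
qed

lemma odd_of_nat_nonzero: "2 * of_nat k + 1 \<noteq> (0 :: 'a :: semiring_char_0)"
proof -
  have "of_nat (2 * k + 1) \<noteq> (0 :: 'a)" by (subst of_nat_eq_0_iff) simp
  then show ?thesis by (simp add: add.commute)
qed

text \<open>Kummer's transformation with a = 1 - m and c = 3/2: this a is a nonpositive integer, so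
  the transformed series terminates.\<close>

lemma kummer_1F1_polynomial:
  "kummer_1F1 (of_nat m + 1 / 2) (3 / 2) w =
     exp w * (\<Sum>k<m. pochhammer (1 - of_nat m) k * (- w) ^ k / (pochhammer (3 / 2) k * fact k))"
  if "m > 0"
proof -
  define Q where "Q = fps_hypergeo [1 - of_nat m] [3 / 2 :: complex] (- 1)"
  have zero: "fps_nth Q k = 0" if "k \<ge> m" for k
  proof -
    have "pochhammer (1 - of_nat m :: complex) k = 0"
      unfolding pochhammer_eq_0_iff using \<open>m > 0\<close> that
      by (intro exI[of _ "m - 1"]) (auto simp: of_nat_diff)
    then show ?thesis by (simp add: Q_def)
  qed
  have radius: "fps_conv_radius Q = \<infinity>"
    unfolding fps_conv_radius_def
    by (intro conv_radius_inftyI'' summable_finite[of "{..<m}"]) (auto simp: zero)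
  have "fps_hypergeo [of_nat m + 1 / 2] [3 / 2 :: complex] 1 = Q * fps_exp 1"
    using kummer_transformation_fps[OF three_halves_not_nonpos, of "1 - of_nat m"] by (simp add: Q_def algebra_simps)
  then have "kummer_1F1 (of_nat m + 1 / 2) (3 / 2) w = eval_fps Q w * exp w"
    unfolding kummer_1F1_def using radius by (simp add: eval_fps_mult)
  moreover have "eval_fps Q w = (\<Sum>k<m. fps_nth Q k * w ^ k)"
    unfolding eval_fps_def by (rule suminf_finite) (auto simp: zero)
  ultimately show ?thesis
    by (simp add: Q_def power_minus[of w] mult_ac)
qed

section \<open>The error function as a confluent hypergeometric function\<close>

lemma pochhammer_half: "pochhammer (1 / 2 :: complex) k * (2 * of_nat k + 1) = pochhammer (3 / 2) k"
  by (induction k) (auto simp: pochhammer_Suc field_simps)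

lemma hypergeo_half_nth:
  "fps_nth (fps_hypergeo [1 / 2] [3 / 2 :: complex] 1) k = 1 / ((2 * of_nat k + 1) * fact k)"
proof -
  have "pochhammer (3 / 2 :: complex) k \<noteq> 0"
    using three_halves_not_nonpos by (auto simp: pochhammer_eq_0_iff)
  then show ?thesis by (auto simp flip: pochhammer_half)
qed

lemma fps_conv_radius_hypergeo_half: "fps_conv_radius (fps_hypergeo [1 / 2] [3 / 2 :: complex] 1) = \<infinity>"
  unfolding fps_conv_radius_def
proof (rule conv_radius_inftyI'')
  fix z :: complex
  have "norm (fps_nth (fps_hypergeo [1 / 2] [3 / 2]  1) k * z ^ k) \<le> inverse (fact k) * norm z ^ k" for k
  proof -
    have "norm (2 * of_nat k + 1 :: complex) = 2 * real k + 1"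
      using norm_of_nat[of "2 * k + 1", where 'a = complex] by (simp add: add.commute)
    then have "norm (fps_nth (fps_hypergeo [1 / 2] [3 / 2 :: complex] 1) k) \<le> inverse (fact k)"
      unfolding hypergeo_half_nth norm_divide norm_mult norm_fact norm_one
      by (simp only:) (auto simp: inverse_eq_divide intro!: divide_left_mono mult_pos_pos)
    then show ?thesis
      unfolding norm_mult norm_power by (rule mult_right_mono) simp
  qed
  then show "summable (\<lambda>k. fps_nth (fps_hypergeo [1 / 2] [3 / 2] 1) k * z ^ k)"
    by (intro summable_comparison_test[OF _ summable_exp[of "norm z"]]) blast
qed

text \<open>The series H = 1F1(1/2; 3/2; w) has coefficients 1 / ((2n + 1) n!), hence solves H + 2 w
  H' = exp w. This makes t H(-t^2) a primitive of exp(-t^2).\<close>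

lemma erf_eq_kummer: "erf z = 2 / complex_of_real (sqrt pi) * z * kummer_1F1 (1 / 2) (3 / 2) (- (z ^ 2))"
proof -
  define H where "H = fps_hypergeo [1 / 2] [3 / 2 :: complex] 1"
  have radius: "fps_conv_radius H = \<infinity>" "fps_conv_radius (fps_deriv H) = \<infinity>"
    using fps_conv_radius_hypergeo_half fps_conv_radius_deriv[of H] by (simp_all add: H_def)
  have "H + fps_const 2 * (fps_X * fps_deriv H) = fps_exp 1"
  proof (rule fps_ext)
    fix n
    have "fps_nth (H + fps_const 2 * (fps_X * fps_deriv H)) n = (2 * of_nat n + 1) * fps_nth H n"
      by (cases n) (simp_all add: algebra_simps)
    also have "\<dots> = fps_nth (fps_exp 1) n"
      unfolding H_def hypergeo_half_nth using odd_of_nat_nonzero[of n, where 'a = complex] by simp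
    finally show "fps_nth (H + fps_const 2 * (fps_X * fps_deriv H)) n = fps_nth (fps_exp 1) n" .
  qed
  moreover have "fps_conv_radius (fps_X * fps_deriv H) = \<infinity>"
      "fps_conv_radius (fps_const 2 * (fps_X * fps_deriv H)) = \<infinity>"
    using radius fps_conv_radius_mult_ge[of \<infinity> fps_X "fps_deriv H"]
      fps_conv_radius_mult_ge[of \<infinity> "fps_const 2" "fps_X * fps_deriv H"] by auto
  ultimately have ode: "eval_fps H w + 2 * (w * eval_fps (fps_deriv H) w) = exp w" for w
    using radius eval_fps_add[of w H "fps_const 2 * (fps_X * fps_deriv H)"]
    by (simp add: eval_fps_mult)
  have D: "((\<lambda>t. t * eval_fps H (- (t ^ 2))) has_field_derivative exp (- (t ^ 2))) (at t)" for t
  proof -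
    from ode[of "- (t ^ 2)"] show ?thesis
      using radius by (auto intro!: derivative_eq_intros simp: power2_eq_square algebra_simps)
  qed
  have "((\<lambda>t. exp (- (t ^ 2))) has_contour_integral
      (pathfinish (linepath 0 z) * eval_fps H (- (pathfinish (linepath 0 z) ^ 2))
       - pathstart (linepath 0 z) * eval_fps H (- (pathstart (linepath 0 z) ^ 2)))) (linepath 0 z)"
    by (rule contour_integral_primitive[OF D valid_path_linepath subset_UNIV])
  then have "contour_integral (linepath 0 z) (\<lambda>t. exp (- (t ^ 2))) = z * eval_fps H (- (z ^ 2))"
    by (simp add: contour_integral_unique)
  then show ?thesis
    by (simp add: erf_def kummer_1F1_def H_def)
qed

section \<open>Taylor expansion of the integrand and its moments\<close>

text \<open>The coefficient of u^(2j+1) in exp(-u^2) sinh(u z), as a Cauchy product; equivalently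
  the Hermite value H_(2j+1)(z/2) / (2j+1)!.\<close>

definition gauss_sinh_coeff :: "complex \<Rightarrow> nat \<Rightarrow> complex" where
  "gauss_sinh_coeff z j = (\<Sum>i\<le>j. (- 1) ^ i / fact i * (z ^ (2 * (j - i) + 1) / fact (2 * (j - i) + 1)))"

lemma sinh_odd_sums: "(\<lambda>l. w ^ (2 * l + 1) / fact (2 * l + 1)) sums sinh (w :: complex)"
proof -
  have "(\<lambda>l. (\<lambda>n. if even n then 0 else w ^ n /\<^sub>R fact n) (2 * l + 1)) sums sinh w"
  proof (subst sums_mono_reindex)
    show "strict_mono (\<lambda>l::nat. 2 * l + 1)" by (simp add: strict_mono_def)
    show "(if even n then 0 else w ^ n /\<^sub>R fact n) = 0" if "n \<notin> range (\<lambda>l. 2 * l + 1)" for n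
      using that by (auto elim!: oddE)
  qed (rule sinh_converges)
  then show ?thesis
    by (simp add: scaleR_conv_of_real divide_inverse mult.commute del: fact_Suc)
qed

lemma gauss_sinh_sums:
  "(\<lambda>j. gauss_sinh_coeff z j * u ^ (2 * j + 1)) sums (exp (- (u ^ 2)) * sinh (u * z))"
  and gauss_sinh_summable: "summable (\<lambda>j. norm (gauss_sinh_coeff z j * u ^ (2 * j + 1)))"
proof -
  define A where "A = (\<lambda>i. (- (u ^ 2)) ^ i /\<^sub>R fact i)"
  define B where "B = (\<lambda>l. (u * z) ^ (2 * l + 1) / fact (2 * l + 1))"
  have A: "A sums exp (- (u ^ 2))" "summable (\<lambda>i. norm (A i))"
    unfolding A_def by (rule exp_converges, rule summable_norm_exp)
  have nB: "norm (B l) = norm (u * z) ^ (2 * l + 1) / fact (2 * l + 1)" for l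
    by (simp add: B_def norm_divide norm_power norm_fact del: fact_Suc power_Suc)
  have B: "B sums sinh (u * z)" "summable (\<lambda>l. norm (B l))"
  proof -
    show "B sums sinh (u * z)" unfolding B_def by (rule sinh_odd_sums)
    \<comment> \<open>The norms are themselves the terms of the sinh series at the nonnegative real
      point |u z|, which yields absolute convergence.\<close>
    have "(\<lambda>l. complex_of_real (norm (B l))) sums sinh (complex_of_real (norm (u * z)))"
      using sinh_odd_sums[of "complex_of_real (norm (u * z))"] unfolding nB by simp
    then show "summable (\<lambda>l. norm (B l))"
      by (simp add: sums_iff summable_complex_of_real)
  qed
  have eq: "(\<Sum>i\<le>j. A i * B (j - i)) = gauss_sinh_coeff z j * u ^ (2 * j + 1)" for j
    unfolding gauss_sinh_coeff_def sum_distrib_right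
  proof (rule sum.cong)
    fix i assume i: "i \<in> {..j}"
    have "u ^ (2 * j + 1) = (u ^ 2) ^ i * u ^ (2 * (j - i) + 1)"
      unfolding power_mult[symmetric] power_add[symmetric] using i by (intro arg_cong[of _ _ "power u"]) auto
    moreover have "(- (u ^ 2)) ^ i = (- 1) ^ i * (u ^ 2) ^ i"
      by (rule power_minus)
    ultimately show "A i * B (j - i) = (- 1) ^ i / fact i * (z ^ (2 * (j - i) + 1) / fact (2 * (j - i) + 1)) * u ^ (2 * j + 1)"
      by (simp only: A_def B_def power_mult_distrib scaleR_conv_of_real of_real_inverse of_real_fact divide_inverse mult_ac)
  qed simp
  show "(\<lambda>j. gauss_sinh_coeff z j * u ^ (2 * j + 1)) sums (exp (- (u ^ 2)) * sinh (u * z))"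
    using Cauchy_product_sums[OF A(2) B(2)] A(1) B(1) unfolding eq by (simp add: sums_iff)
  have "(\<lambda>j. \<Sum>i\<le>j. norm (A i) * norm (B (j - i))) sums ((\<Sum>i. norm (A i)) * (\<Sum>i. norm (B i)))"
    by (rule Cauchy_product_sums) (use A(2) B(2) in simp_all)
  then have s: "summable (\<lambda>j. \<Sum>i\<le>j. norm (A i) * norm (B (j - i)))" by (simp add: sums_iff)
  have "norm (gauss_sinh_coeff z j * u ^ (2 * j + 1)) \<le> (\<Sum>i\<le>j. norm (A i) * norm (B (j - i)))" for j
    unfolding eq[symmetric] norm_mult[symmetric] by (rule norm_sum)
  then show "summable (\<lambda>j. norm (gauss_sinh_coeff z j * u ^ (2 * j + 1)))"
    by (intro summable_comparison_test[OF _ s]) simp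
qed

text \<open>For real u the Gaussian beats the growth of sinh, by expanding the square of |u| -
  |z|.\<close>

lemma norm_gauss_sinh_le:
  fixes u :: real
  shows "norm (exp (- (complex_of_real u ^ 2)) * sinh (complex_of_real u * z)) \<le> exp (norm z ^ 2)"
proof -
  have "norm (sinh (complex_of_real u * z)) \<le> (norm (exp (of_real u * z)) + norm (exp (- (of_real u * z)))) / 2"
    unfolding sinh_field_def norm_divide using norm_triangle_ineq4 by (simp del: norm_exp_eq_Re)
  also have "\<dots> \<le> (exp (\<bar>u\<bar> * norm z) + exp (\<bar>u\<bar> * norm z)) / 2"
    by (intro divide_right_mono add_mono order.trans[OF norm_exp]) (simp_all add: norm_mult)
  finally have sinh: "norm (sinh (complex_of_real u * z)) \<le> exp (\<bar>u\<bar> * norm z)" by simp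
  have "norm (exp (- (complex_of_real u ^ 2))) = exp (- (u ^ 2))"
    by (simp add: norm_exp_eq_Re)
  then have "norm (exp (- (complex_of_real u ^ 2)) * sinh (complex_of_real u * z)) \<le> exp (- (u ^ 2)) * exp (\<bar>u\<bar> * norm z)"
    using sinh by (simp add: norm_mult)
  also have "\<dots> = exp (\<bar>u\<bar> * norm z - u ^ 2)" by (simp add: exp_add[symmetric])
  also have "\<dots> \<le> exp (norm z ^ 2)"
  proof -
    have "(\<bar>u\<bar> - norm z) ^ 2 = u ^ 2 - 2 * (\<bar>u\<bar> * norm z) + norm z ^ 2"
      by (simp add: power2_diff)
    moreover have "0 \<le> \<bar>u\<bar> * norm z" by simp
    ultimately have "\<bar>u\<bar> * norm z - u ^ 2 \<le> norm z ^ 2"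
      using zero_le_power2[of "\<bar>u\<bar> - norm z"] by linarith
    then show ?thesis by simp
  qed
  finally show ?thesis .
qed

text \<open>On [0, 1] the Taylor tail is at most u^(2N+1) times the sum of the coefficient norms,
  finite by absolute convergence at u = 1. For u at least 1 the function is bounded and all
  subtracted powers are smaller than u^(2N+1).\<close>

lemma gauss_sinh_remainder:
  "\<exists>C\<ge>0. \<forall>u\<ge>0. norm (exp (- (complex_of_real u ^ 2)) * sinh (complex_of_real u * z)
      - (\<Sum>j<N. gauss_sinh_coeff z j * complex_of_real u ^ (2 * j + 1))) \<le> C * u ^ (2 * N + 1)"
proof -
  define a where "a = gauss_sinh_coeff z"
  define F where "F = (\<lambda>u. exp (- (complex_of_real u ^ 2)) * sinh (complex_of_real u * z))"
  have a: "summable (\<lambda>j. norm (a j))"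
    using gauss_sinh_summable[of z 1] by (simp add: a_def)
  define C1 where "C1 = (\<Sum>j. norm (a (j + N)))"
  define C2 where "C2 = exp (norm z ^ 2) + (\<Sum>j<N. norm (a j))"
  have small: "norm (F u - (\<Sum>j<N. a j * complex_of_real u ^ (2 * j + 1))) \<le> C1 * u ^ (2 * N + 1)"
    if u: "0 \<le> u" "u \<le> 1" for u
  proof -
    have "(\<lambda>j. a (j + N) * complex_of_real u ^ (2 * (j + N) + 1)) sums
        (F u - (\<Sum>j<N. a j * complex_of_real u ^ (2 * j + 1)))"
      using gauss_sinh_sums[of z "of_real u"] unfolding a_def F_def by (rule sums_split_initial_segment)
    then have "norm (F u - (\<Sum>j<N. a j * complex_of_real u ^ (2 * j + 1))) =
        norm (\<Sum>j. a (j + N) * complex_of_real u ^ (2 * (j + N) + 1))"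
      by (simp only: sums_iff)
    also have "\<dots> \<le> (\<Sum>j. norm (a (j + N)) * u ^ (2 * N + 1))"
    proof (rule norm_suminf_le)
      show "summable (\<lambda>j. norm (a (j + N)) * u ^ (2 * N + 1))"
        by (intro summable_mult2) (subst summable_iff_shift, rule a)
      show "norm (a (j + N) * complex_of_real u ^ (2 * (j + N) + 1)) \<le> norm (a (j + N)) * u ^ (2 * N + 1)" for j
        using u by (simp only: norm_mult norm_power norm_of_real abs_of_nonneg)
           (intro mult_left_mono power_decreasing, auto)
    qed
    also have "\<dots> = C1 * u ^ (2 * N + 1)"
      unfolding C1_def by (rule suminf_mult2[symmetric]) (subst summable_iff_shift, rule a)
    finally show ?thesis .
  qed
  have large: "norm (F u - (\<Sum>j<N. a j * complex_of_real u ^ (2 * j + 1))) \<le> C2 * u ^ (2 * N + 1)"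
    if u: "u \<ge> 1" for u
  proof -
    have "norm (F u - (\<Sum>j<N. a j * complex_of_real u ^ (2 * j + 1))) \<le>
        norm (F u) + (\<Sum>j<N. norm (a j * complex_of_real u ^ (2 * j + 1)))"
      by (intro order.trans[OF norm_triangle_ineq4] add_left_mono norm_sum)
    also have "\<dots> \<le> exp (norm z ^ 2) * u ^ (2 * N + 1) + (\<Sum>j<N. norm (a j) * u ^ (2 * N + 1))"
    proof (intro add_mono sum_mono)
      have "norm (F u) \<le> exp (norm z ^ 2) * 1"
        unfolding F_def using norm_gauss_sinh_le by simp
      also have "\<dots> \<le> exp (norm z ^ 2) * u ^ (2 * N + 1)"
        by (intro mult_left_mono one_le_power) (use u in auto)
      finally show "norm (F u) \<le> exp (norm z ^ 2) * u ^ (2 * N + 1)" .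
      show "norm (a j * complex_of_real u ^ (2 * j + 1)) \<le> norm (a j) * u ^ (2 * N + 1)" if "j \<in> {..<N}" for j
      proof -
        have "u ^ (2 * j + 1) \<le> u ^ (2 * N + 1)"
          by (rule power_increasing) (use u that in auto)
        then show ?thesis
          using u by (simp only: norm_mult norm_power norm_of_real) (simp add: mult_left_mono)
      qed
    qed
    also have "\<dots> = C2 * u ^ (2 * N + 1)"
      by (simp only: C2_def distrib_right sum_distrib_right)
    finally show ?thesis .
  qed
  have "C1 \<ge> 0"
    unfolding C1_def by (rule suminf_nonneg) (subst summable_iff_shift, rule a, simp)
  moreover have "C2 \<ge> 0" by (simp add: C2_def sum_nonneg add_nonneg_nonneg)
  ultimately have "norm (F u - (\<Sum>j<N. a j * complex_of_real u ^ (2 * j + 1))) \<le> (C1 + C2) * u ^ (2 * N + 1)"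
    if "u \<ge> 0" for u
  proof -
    have "C1 * u ^ (2 * N + 1) \<le> (C1 + C2) * u ^ (2 * N + 1)" "C2 * u ^ (2 * N + 1) \<le> (C1 + C2) * u ^ (2 * N + 1)"
      using \<open>C1 \<ge> 0\<close> \<open>C2 \<ge> 0\<close> that by (auto intro!: mult_right_mono)
    then show ?thesis
      using small[of u] large[of u] that by (meson linear order.trans)
  qed
  with \<open>C1 \<ge> 0\<close> \<open>C2 \<ge> 0\<close> show ?thesis
    unfolding a_def F_def by (intro exI[of _ "C1 + C2"]) auto
qed

lemma has_bochner_integral_power_exp:
  fixes l :: real
  assumes l: "l > 0"
  shows "has_bochner_integral lborel (\<lambda>x. indicator {0<..} x * (x ^ k * exp (- l * x))) (fact k / l ^ Suc k)"
proof (rule has_bochner_integral_nn_integral)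
  have "(\<integral>\<^sup>+x. ennreal (indicator {0<..} x * (x ^ k * exp (- l * x))) \<partial>lborel) =
      (\<integral>\<^sup>+x. ennreal (1 / l) * ennreal (erlang_density 0 l x * x ^ k) \<partial>lborel)"
  proof (rule nn_integral_cong_AE)
    \<comment> \<open>The Erlang density is positive at 0, whereas the indicator vanishes there; for
      k = 0 the integrands differ at that point.\<close>
    have "AE x in lborel. x \<noteq> (0 :: real)" by (rule AE_lborel_singleton)
    then show "AE x in lborel. ennreal (indicator {0<..} x * (x ^ k * exp (- l * x))) =
        ennreal (1 / l) * ennreal (erlang_density 0 l x * x ^ k)"
      by eventually_elim
         (use l in \<open>auto simp: erlang_density_def ennreal_mult'[symmetric] mult_ac split: split_indicator\<close>)
  qed
  also have "\<dots> = ennreal (1 / l) * ennreal (fact k / l ^ k)"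
    using nn_integral_erlang_ith_moment[OF l, of 0 k] by (subst nn_integral_cmult) auto
  also have "\<dots> = ennreal (fact k / l ^ Suc k)"
    using l by (simp add: ennreal_mult'[symmetric])
  finally show "(\<integral>\<^sup>+x. ennreal (indicator {0<..} x * (x ^ k * exp (- l * x))) \<partial>lborel) = ennreal (fact k / l ^ Suc k)" .
qed (use l in \<open>auto split: split_indicator\<close>)

text \<open>The geometric series of 1 / (exp(2 pi x) - 1) is integrated term by term, its terms
  being nonnegative; the condition on k makes the resulting zeta series converge.\<close>

lemma has_bochner_integral_power_over_exp_minus_1:
  assumes k: "k \<ge> 1"
  shows "has_bochner_integral lborel (\<lambda>x. indicator {0<..} x * (x ^ k / (exp (2 * pi * x) - 1)))
           (fact k * zeta_nat (Suc k) / (2 * pi) ^ Suc k)"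
proof -
  define f where "f = (\<lambda>n x. indicator {0<..} x * (x ^ k * exp (- (2 * pi * real (Suc n)) * x)))"
  define I where "I = (\<lambda>n. fact k / (2 * pi * real (Suc n)) ^ Suc k)"
  have f: "has_bochner_integral lborel (f n) (I n)" for n
    unfolding f_def I_def by (rule has_bochner_integral_power_exp) auto
  have nonneg: "f n x \<ge> 0" for n x
    by (simp add: f_def split: split_indicator)
  have I: "I sums (fact k * zeta_nat (Suc k) / (2 * pi) ^ Suc k)"
    using sums_mult[OF zeta_nat_sums[of "Suc k"], of "fact k / (2 * pi) ^ Suc k"] k
    by (simp add: I_def power_mult_distrib mult_ac del: power_Suc of_nat_Suc)
  have pointwise: "(\<lambda>n. f n x) sums (indicator {0<..} x * (x ^ k / (exp (2 * pi * x) - 1)))" for x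
  proof (cases "x > 0")
    case True
    define q where "q = exp (- 2 * pi * x)"
    have q: "0 < q" "q < 1" using True by (auto simp: q_def)
    have "exp (- (2 * pi * real (Suc n)) * x) = q ^ Suc n" for n
      unfolding q_def exp_of_nat_mult[symmetric] by (simp add: algebra_simps)
    then have "f n x = x ^ k * (q * q ^ n)" for n
      using True by (simp add: f_def)
    moreover have "(\<lambda>n. x ^ k * (q * q ^ n)) sums (x ^ k * (q * (1 / (1 - q))))"
      using q by (intro sums_mult geometric_sums) auto
    moreover have "exp (2 * pi * x) = 1 / q"
      by (simp add: q_def exp_minus field_simps)
    then have "q * (1 / (1 - q)) = 1 / (exp (2 * pi * x) - 1)"
      using q True by (simp add: divide_simps) (simp add: algebra_simps)
    ultimately show ?thesis
      using True by (simp add: divide_inverse)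
  qed (simp add: f_def)
  have int: "integrable lborel (f n)" for n
    using f has_bochner_integral_iff by blast
  have summ: "AE x in lborel. summable (\<lambda>n. norm (f n x))"
    using pointwise nonneg by (auto simp: sums_iff)
  have normI: "(LINT x|lborel. norm (f n x)) = I n" for n
    using f[of n] nonneg[of n] by (simp add: has_bochner_integral_iff)
  have summI: "summable (\<lambda>n. LINT x|lborel. norm (f n x))"
    unfolding normI using I by (simp add: sums_iff)
  have eq: "(\<lambda>x. \<Sum>n. f n x) = (\<lambda>x. indicator {0<..} x * (x ^ k / (exp (2 * pi * x) - 1)))"
    using pointwise by (auto simp: sums_iff)
  have "integral\<^sup>L lborel (f n) = I n" for n
    using f has_bochner_integral_iff by blast
  then show ?thesis
    using integrable_suminf[OF int summ summI] integral_suminf[OF int summ summI] I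
    unfolding has_bochner_integral_iff eq by (simp add: sums_iff)
qed

lemma fact_odd: "fact (2 * k + 1) = (4 :: complex) ^ k * fact k * pochhammer (3 / 2) k"
proof -
  have "fact (2 * k + 1) = (2 * of_nat k + 1) * (fact (2 * k) :: complex)"
    by simp
  also have "fact (2 * k) = 4 ^ k * pochhammer (1 / 2) k * (fact k :: complex)"
    by (simp add: fact_double power_mult)
  finally show ?thesis
    by (simp only: pochhammer_half[symmetric] mult_ac)
qed

text \<open>Reversing the sum and splitting (2k + 1)! by the duplication formula shows a terminating
  1F1(-j; 3/2; z^2/4), the polynomial that Kummer's transformation produces for m = j + 1.\<close>

lemma gauss_sinh_coeff_eq:
  "gauss_sinh_coeff z j = z * (- 1) ^ j / fact j *
     (\<Sum>k<Suc j. pochhammer (- of_nat j) k * (z ^ 2 / 4) ^ k / (pochhammer (3 / 2) k * fact k))"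
proof -
  have "gauss_sinh_coeff z j = (\<Sum>k\<le>j. (- 1) ^ (j - k) / fact (j - k) * (z ^ (2 * k + 1) / fact (2 * k + 1)))"
    unfolding gauss_sinh_coeff_def atMost_atLeast0
    by (subst sum.atLeastAtMost_rev) (auto intro!: sum.cong)
  also have "\<dots> = (\<Sum>k\<le>j. z * (- 1) ^ j / fact j *
      (pochhammer (- of_nat j) k * (z ^ 2 / 4) ^ k / (pochhammer (3 / 2) k * fact k)))"
  proof (rule sum.cong)
    fix k assume "k \<in> {..j}"
    then have k: "k \<le> j" by simp
    have "(- 1 :: complex) ^ (j - k) = (- 1) ^ (j + k)"
      using k by (simp add: minus_one_power_iff)
    moreover have "z ^ (2 * k + 1) = z * (z ^ 2) ^ k" by (simp add: power_mult)
    ultimately show "(- 1) ^ (j - k) / fact (j - k) * (z ^ (2 * k + 1) / fact (2 * k + 1)) = z * (- 1) ^ j / fact j *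
      (pochhammer (- of_nat j) k * (z ^ 2 / 4) ^ k / (pochhammer (3 / 2) k * fact k))"
      unfolding fact_odd pochhammer_minus_of_nat[OF k]
      unfolding \<open>z ^ (2 * k + 1) = z * (z ^ 2) ^ k\<close> by (simp add: power_add power_divide mult_ac)
  qed simp
  finally show ?thesis
    by (simp only: sum_distrib_left lessThan_Suc_atMost)
qed

section \<open>Asymptotic expansion\<close>

text \<open>The integral of x^(2j+1) / (exp(2 pi x) - 1) over the positive half-line.\<close>

definition bose_moment :: "nat \<Rightarrow> real" where
  "bose_moment j = fact (2 * j + 1) * zeta_nat (2 * j + 2) / (2 * pi) ^ (2 * j + 2)"

text \<open>The remainder bound for \<open>exp (- u\<^sup>2) sinh (u z)\<close> holds for all \<open>u \<ge> 0\<close>, so it can be integrated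
  over the whole half-line and no splitting of the integral is needed.\<close>

lemma bose_integral_expansion:
  "\<exists>C. \<forall>\<alpha>>0. norm ((LBINT x:{0<..}. complex_of_real (exp (- \<alpha> * x ^ 2))
          * sinh (complex_of_real (sqrt \<alpha> * x) * z) / complex_of_real (exp (2 * pi * x) - 1)) -
      (\<Sum>j<N. gauss_sinh_coeff z j * of_real (bose_moment j) * of_real (\<alpha> powr (real j + 1 / 2))))
    \<le> C * \<alpha> powr (real N + 1 / 2)"
proof -
  obtain C where C: "C \<ge> 0" "\<And>u. u \<ge> 0 \<Longrightarrow>
      norm (exp (- (complex_of_real u ^ 2)) * sinh (complex_of_real u * z)
        - (\<Sum>j<N. gauss_sinh_coeff z j * complex_of_real u ^ (2 * j + 1))) \<le> C * u ^ (2 * N + 1)"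
    using gauss_sinh_remainder[of z N] by blast
  define p where "p = (\<lambda>j x. indicator {0<..} x * (x ^ (2 * j + 1) / (exp (2 * pi * x) - 1)) :: real)"
  have p: "has_bochner_integral lborel (p j) (bose_moment j)" for j
    using has_bochner_integral_power_over_exp_minus_1[of "2 * j + 1"] by (simp add: p_def bose_moment_def)
  have "norm ((LBINT x:{0<..}. complex_of_real (exp (- \<alpha> * x ^ 2))
          * sinh (complex_of_real (sqrt \<alpha> * x) * z) / complex_of_real (exp (2 * pi * x) - 1)) -
      (\<Sum>j<N. gauss_sinh_coeff z j * of_real (bose_moment j) * of_real (\<alpha> powr (real j + 1 / 2))))
    \<le> C * bose_moment N * \<alpha> powr (real N + 1 / 2)" if \<alpha>: "\<alpha> > 0" for \<alpha>
  proof -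
    define G where "G = (\<lambda>x. indicator {0<..} x *\<^sub>R (complex_of_real (exp (- \<alpha> * x ^ 2))
          * sinh (complex_of_real (sqrt \<alpha> * x) * z) / complex_of_real (exp (2 * pi * x) - 1)))"
    define P where "P = (\<lambda>x. \<Sum>j<N. gauss_sinh_coeff z j * of_real (\<alpha> powr (real j + 1 / 2)) * complex_of_real (p j x))"
    have pw: "sqrt \<alpha> ^ (2 * j + 1) = \<alpha> powr (real j + 1 / 2)" for j
      using \<alpha> by (simp add: powr_add powr_realpow power_mult[of "sqrt \<alpha>"] powr_half_sqrt)
    \<comment> \<open>The remainder bound at u = sqrt \<alpha> x, divided by the positive weight;
      the powers of \<alpha> separate from those of x.\<close>
    have bound: "norm (G x - P x) \<le> C * \<alpha> powr (real N + 1 / 2) * p N x" for x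
    proof (cases "x > 0")
      case True
      define w where "w = exp (2 * pi * x) - 1"
      have w: "w > 0" using True by (simp add: w_def)
      define u where "u = sqrt \<alpha> * x"
      have u: "u \<ge> 0" using True \<alpha> by (simp add: u_def)
      have pow: "u ^ (2 * j + 1) = \<alpha> powr (real j + 1 / 2) * x ^ (2 * j + 1)" for j
        unfolding u_def power_mult_distrib pw ..
      have "exp (- (complex_of_real u ^ 2)) = complex_of_real (exp (- \<alpha> * x ^ 2))"
        using \<alpha> by (simp add: u_def power_mult_distrib exp_of_real flip: of_real_power of_real_mult of_real_minus)
      then have "G x = exp (- (complex_of_real u ^ 2)) * sinh (complex_of_real u * z) / of_real w"
        using True by (simp add: G_def w_def u_def)
      moreover have "P x = (\<Sum>j<N. gauss_sinh_coeff z j * complex_of_real u ^ (2 * j + 1)) / of_real w"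
        unfolding P_def sum_divide_distrib of_real_power[symmetric] pow
        using True by (intro sum.cong) (simp_all add: p_def w_def)
      ultimately have "norm (G x - P x) = norm (exp (- (complex_of_real u ^ 2)) * sinh (complex_of_real u * z)
        - (\<Sum>j<N. gauss_sinh_coeff z j * complex_of_real u ^ (2 * j + 1))) / w"
        using w by (simp only: diff_divide_distrib[symmetric] norm_divide norm_of_real abs_of_pos)
      also have "\<dots> \<le> C * u ^ (2 * N + 1) / w"
        using C(2)[OF u] w by (intro divide_right_mono) auto
      also have "\<dots> = C * \<alpha> powr (real N + 1 / 2) * p N x"
        unfolding pow using True by (simp add: p_def w_def)
      finally show ?thesis .
    qed (simp add: G_def P_def p_def)
    have [measurable]: "p j \<in> borel_measurable lborel" for j
      using p has_bochner_integral_iff borel_measurable_integrable by blast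
    have "(\<lambda>x. sinh (complex_of_real (sqrt \<alpha> * x) * z)) \<in> borel_measurable lborel"
      by (simp, intro borel_measurable_continuous_onI continuous_intros)
    note [measurable] = this
    have [measurable]: "G \<in> borel_measurable lborel" "P \<in> borel_measurable lborel"
      unfolding G_def P_def by measurable
    have pN: "integrable lborel (\<lambda>x. C * \<alpha> powr (real N + 1 / 2) * p N x)"
      "(LINT x|lborel. C * \<alpha> powr (real N + 1 / 2) * p N x) = C * bose_moment N * \<alpha> powr (real N + 1 / 2)"
      using p[of N] by (auto simp: has_bochner_integral_iff)
    \<comment> \<open>Only the difference is dominated by an integrable function; \<open>G\<close>
      is then handled as \<open>(G - P) + P\<close>.\<close>
    have D: "integrable lborel (\<lambda>x. G x - P x)"
      by (rule Bochner_Integration.integrable_bound[OF pN(1)]) (auto intro!: AE_I2 order.trans[OF bound])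
    have P: "has_bochner_integral lborel P (\<Sum>j<N. gauss_sinh_coeff z j * of_real (\<alpha> powr (real j + 1 / 2)) * complex_of_real (bose_moment j))"
      unfolding P_def by (intro has_bochner_integral_sum has_bochner_integral_mult_right has_bochner_integral_of_real p)
    have "integral\<^sup>L lborel G = (LINT x|lborel. (G x - P x) + P x)" by simp
    also have "\<dots> = (LINT x|lborel. G x - P x) + integral\<^sup>L lborel P"
      using D P by (intro Bochner_Integration.integral_add) (auto simp: has_bochner_integral_iff)
    finally have "integral\<^sup>L lborel G - integral\<^sup>L lborel P = (LINT x|lborel. G x - P x)" by simp
    also have "norm \<dots> \<le> (LINT x|lborel. C * \<alpha> powr (real N + 1 / 2) * p N x)"
      by (rule Bochner_Integration.integral_norm_bound_integral[OF D pN(1)]) (use bound in auto)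
    finally have "norm (integral\<^sup>L lborel G - integral\<^sup>L lborel P) \<le> C * bose_moment N * \<alpha> powr (real N + 1 / 2)"
      unfolding pN .
    then show ?thesis
      using P by (simp add: has_bochner_integral_iff G_def set_lebesgue_integral_def mult_ac)
  qed
  then show ?thesis by blast
qed

text \<open>The index is shifted by one: the Taylor term j carries \<alpha>^(1/4) \<alpha>^(j +
  1/2), which is the scale function of index j + 1. Index 0 belongs to the error function
  term.\<close>

definition I_coeff :: "complex \<Rightarrow> nat \<Rightarrow> complex" where
  "I_coeff z m = (case m of
     0 \<Rightarrow> complex_of_real (sqrt pi) / z * exp (z ^ 2 / 8) * erf (z / 2)
   | Suc j \<Rightarrow> 4 / z * exp (- (z ^ 2) / 8) * gauss_sinh_coeff z j * of_real (bose_moment j))"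

text \<open>The error function term cancels exactly, so what remains is a multiple of the error for
  the integral. The bound is the scale function of index N + 1.\<close>

lemma I_fun_expansion:
  "\<exists>C. \<forall>\<alpha>>0. norm (I_fun z \<alpha> - (\<Sum>m\<le>N. I_coeff z m * of_real (\<alpha> powr (real m - 1 / 4))))
     \<le> C * \<alpha> powr (real N + 3 / 4)"
proof -
  let ?J = "\<lambda>\<alpha>. LBINT x:{0<..}. complex_of_real (exp (- \<alpha> * x ^ 2))
          * sinh (complex_of_real (sqrt \<alpha> * x) * z) / complex_of_real (exp (2 * pi * x) - 1)"
  let ?S = "\<lambda>\<alpha>. \<Sum>j<N. gauss_sinh_coeff z j * of_real (bose_moment j) * of_real (\<alpha> powr (real j + 1 / 2))"
  let ?E = "4 / z * exp (- (z ^ 2) / 8)"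
  obtain C where C: "\<And>\<alpha>. \<alpha> > 0 \<Longrightarrow> norm (?J \<alpha> - ?S \<alpha>) \<le> C * \<alpha> powr (real N + 1 / 2)"
    using bose_integral_expansion[of z N] by blast
  have "norm (I_fun z \<alpha> - (\<Sum>m\<le>N. I_coeff z m * of_real (\<alpha> powr (real m - 1 / 4))))
     \<le> norm ?E * C * \<alpha> powr (real N + 3 / 4)" if \<alpha>: "\<alpha> > 0" for \<alpha>
  proof -
    have "(\<Sum>m\<le>N. I_coeff z m * of_real (\<alpha> powr (real m - 1 / 4))) =
        I_coeff z 0 * of_real (\<alpha> powr (- 1 / 4)) + (\<Sum>j<N. I_coeff z (Suc j) * of_real (\<alpha> powr (real (Suc j) - 1 / 4)))"
      by (subst sum.atMost_shift) simp
    also have "(\<Sum>j<N. I_coeff z (Suc j) * of_real (\<alpha> powr (real (Suc j) - 1 / 4))) = ?E * of_real (\<alpha> powr (1 / 4)) * ?S \<alpha>"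
      unfolding sum_distrib_left
    proof (rule sum.cong)
      fix j
      have "\<alpha> powr (real (Suc j) - 1 / 4) = \<alpha> powr (1 / 4) * \<alpha> powr (real j + 1 / 2)"
        by (simp add: powr_add[symmetric] algebra_simps)
      then show "I_coeff z (Suc j) * of_real (\<alpha> powr (real (Suc j) - 1 / 4)) = ?E * of_real (\<alpha> powr (1 / 4)) *
          (gauss_sinh_coeff z j * of_real (bose_moment j) * of_real (\<alpha> powr (real j + 1 / 2)))"
        by (simp add: I_coeff_def)
    qed simp
    finally have "I_fun z \<alpha> - (\<Sum>m\<le>N. I_coeff z m * of_real (\<alpha> powr (real m - 1 / 4))) =
        ?E * of_real (\<alpha> powr (1 / 4)) * (?J \<alpha> - ?S \<alpha>)"
      unfolding I_fun_def right_diff_distrib by (simp add: I_coeff_def mult_ac)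
    then have "norm (I_fun z \<alpha> - (\<Sum>m\<le>N. I_coeff z m * of_real (\<alpha> powr (real m - 1 / 4)))) =
        norm ?E * \<alpha> powr (1 / 4) * norm (?J \<alpha> - ?S \<alpha>)"
      by (simp only: norm_mult norm_of_real) simp
    also have "\<dots> \<le> norm ?E * \<alpha> powr (1 / 4) * (C * \<alpha> powr (real N + 1 / 2))"
      by (intro mult_left_mono C \<alpha>) auto
    also have "\<dots> = norm ?E * C * (\<alpha> powr (1 / 4) * \<alpha> powr (real N + 1 / 2))"
      by (simp only: mult_ac)
    also have "\<alpha> powr (1 / 4) * \<alpha> powr (real N + 1 / 2) = \<alpha> powr (real N + 3 / 4)"
      by (simp add: powr_add[symmetric] algebra_simps)
    finally show ?thesis .
  qed
  then show ?thesis by blast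
qed

lemma powr_smallo_at_right_0:
  fixes a b :: real
  assumes "a < b"
  shows "(\<lambda>x. complex_of_real (x powr b)) \<in> o[at_right 0](\<lambda>x. complex_of_real (x powr a))"
proof (rule smalloI_tendsto)
  have "((\<lambda>x. complex_of_real (x powr (b - a))) \<longlongrightarrow> of_real (0 powr (b - a))) (at_right 0)"
    by (intro tendsto_of_real tendsto_powr'[OF tendsto_ident_at tendsto_const])
       (use assms in \<open>auto simp: eventually_at_filter\<close>)
  then show "((\<lambda>x. complex_of_real (x powr b) / complex_of_real (x powr a)) \<longlongrightarrow> 0) (at_right 0)"
    using assms by (simp add: powr_diff)
  show "\<forall>\<^sub>F x in at_right 0. complex_of_real (x powr a) \<noteq> 0"
    using eventually_at_right_less[of 0] by eventually_elim simp
qed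

lemma poincare_expansion_I_coeff:
  "poincare_expansion (at_right 0) quarter_scale (I_fun z) (\<lambda>m \<alpha>. I_coeff z m * of_real (\<alpha> powr (real m - 1 / 4)))"
  unfolding poincare_expansion_def
proof (intro conjI allI)
  show "quarter_scale (Suc m) \<in> o[at_right 0](quarter_scale m)" for m
    unfolding quarter_scale_def by (rule powr_smallo_at_right_0) simp
  show "\<exists>c. \<forall>\<^sub>F x in at_right 0. I_coeff z m * of_real (x powr (real m - 1 / 4)) = c * quarter_scale m x" for m
    by (auto simp: quarter_scale_def)
  fix N
  obtain C where C: "\<And>\<alpha>. \<alpha> > 0 \<Longrightarrow> norm (I_fun z \<alpha> - (\<Sum>m\<le>N. I_coeff z m * of_real (\<alpha> powr (real m - 1 / 4))))
     \<le> C * \<alpha> powr (real N + 3 / 4)"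
    using I_fun_expansion[of z N] by blast
  have "(\<lambda>\<alpha>. I_fun z \<alpha> - (\<Sum>m\<le>N. I_coeff z m * of_real (\<alpha> powr (real m - 1 / 4)))) \<in> O[at_right 0](\<lambda>\<alpha>. complex_of_real (\<alpha> powr (real N + 3 / 4)))"
    by (rule bigoI[of _ C]) (use eventually_at_right_less[of 0] C in \<open>auto elim!: eventually_mono\<close>)
  then show "(\<lambda>\<alpha>. I_fun z \<alpha> - (\<Sum>m\<le>N. I_coeff z m * of_real (\<alpha> powr (real m - 1 / 4)))) \<in> o[at_right 0](quarter_scale N)"
    unfolding quarter_scale_def by (rule landau_o.big_small_trans) (rule powr_smallo_at_right_0, simp)
qed

lemma poincare_expansion_cong:
  assumes "\<And>m. \<forall>\<^sub>F x in F. g m x = h m x"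
  shows "poincare_expansion F \<phi> f g \<longleftrightarrow> poincare_expansion F \<phi> f h"
proof -
  have "(\<exists>c. \<forall>\<^sub>F x in F. g m x = c * \<phi> m x) \<longleftrightarrow> (\<exists>c. \<forall>\<^sub>F x in F. h m x = c * \<phi> m x)" for m
  proof (rule ex_cong1, rule eventually_subst)
    show "\<forall>\<^sub>F x in F. (g m x = c * \<phi> m x) = (h m x = c * \<phi> m x)" for c
      using assms[of m] by eventually_elim simp
  qed
  moreover have "(\<lambda>x. f x - (\<Sum>m\<le>N. g m x)) \<in> o[F](\<phi> N) \<longleftrightarrow> (\<lambda>x. f x - (\<Sum>m\<le>N. h m x)) \<in> o[F](\<phi> N)" for N
  proof (rule landau_o.small.in_cong)
    have "\<forall>\<^sub>F x in F. \<forall>m\<in>{..N}. g m x = h m x"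
      by (intro eventually_ball_finite ballI assms) simp
    then show "\<forall>\<^sub>F x in F. f x - (\<Sum>m\<le>N. g m x) = f x - (\<Sum>m\<le>N. h m x)"
      by eventually_elim simp
  qed
  ultimately show ?thesis unfolding poincare_expansion_def by simp
qed

section \<open>Matching the two forms of the coefficients\<close>

lemma Gamma_of_nat_plus_half:
  "Gamma (of_nat m + 1 / 2 :: complex) = pochhammer (1 / 2) m * of_real (sqrt pi)"
proof -
  have "(1 / 2 :: complex) \<notin> \<int>\<^sub>\<le>\<^sub>0"
    by (auto elim!: nonpos_Ints_cases simp: complex_eq_iff)
  then have "pochhammer (1 / 2) m = Gamma (1 / 2 + of_nat m) / Gamma (1 / 2 :: complex)"
    by (rule pochhammer_Gamma)
  then show ?thesis
    by (simp add: Gamma_one_half_complex add.commute field_simps)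
qed

text \<open>For m = 0 this combines zeta(0) = -1/2, Gamma(1/2) = sqrt(pi) and the Kummer form of
  erf. For m = j + 1 both sides contain the same polynomial \<open>Q\<close>, and the constants
  agree by the duplication formula.\<close>

lemma hypergeometric_term_eq_I_coeff:
  assumes z: "z \<noteq> 0"
  shows "- 2 / complex_of_real (sqrt pi) * exp (z ^ 2 / 8) * ((- 1 / of_real (pi ^ 2)) ^ m *
      riemann_zeta (2 * of_nat m) * Gamma (of_nat m + 1 / 2) *
      kummer_1F1 (of_nat m + 1 / 2) (3 / 2) (- (z ^ 2) / 4)) = I_coeff z m"
proof (cases m)
  case 0
  then show ?thesis
    using z by (simp add: I_coeff_def riemann_zeta_0 Gamma_one_half_complex erf_eq_kummer power_divide)
next
  case (Suc j)
  define Q where "Q = (\<Sum>k<m. pochhammer (1 - of_nat m) k * (z ^ 2 / 4) ^ k / (pochhammer (3 / 2) k * fact k))"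
  have K: "kummer_1F1 (of_nat m + 1 / 2) (3 / 2) (- (z ^ 2) / 4) = exp (- (z ^ 2) / 4) * Q"
    using kummer_1F1_polynomial[of m "- (z ^ 2) / 4"] Suc by (simp add: Q_def)
  have a: "gauss_sinh_coeff z j = z * (- 1) ^ j / fact j * Q"
    unfolding gauss_sinh_coeff_eq Q_def Suc by simp
  have e: "exp (z ^ 2 / 8) * exp (- (z ^ 2) / 4) = exp (- (z ^ 2) / 8)"
    by (simp add: exp_add[symmetric])
  have "riemann_zeta (2 * of_nat m) = riemann_zeta (of_nat (2 * m))" by simp
  also have "\<dots> = of_real (zeta_nat (2 * m))"
    by (rule riemann_zeta_of_nat) (use Suc in auto)
  finally have Z: "riemann_zeta (2 * of_nat m) = of_real (zeta_nat (2 * m))" .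
  \<comment> \<open>Both sides are (2m)!, as m = j + 1; cancelling m leaves the relation between (2j
    + 1)! and \<open>pochhammer (1 / 2) m\<close>.\<close>
  have "2 * of_nat m * fact (2 * j + 1) = (4 ^ m * pochhammer (1 / 2) m * (of_nat m * fact j) :: complex)"
    using fact_double[of m, where 'a = complex] Suc by (simp add: power_mult)
  then have F: "2 * fact (2 * j + 1) = (4 ^ m * pochhammer (1 / 2) m * fact j :: complex)"
    using Suc by (simp del: fact_Suc of_nat_Suc add: mult.left_commute[of _ "of_nat _"])
  define P where "P = complex_of_real pi ^ (2 * m)"
  have P: "P \<noteq> 0" by (simp add: P_def)
  have pow: "(- 1 / complex_of_real (pi ^ 2)) ^ m = (- 1) ^ m / P"
    by (simp only: P_def power_divide power_mult of_real_power)
  have "complex_of_real (bose_moment j) = fact (2 * j + 1) * of_real (zeta_nat (2 * m)) / (4 ^ m * P)"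
    unfolding bose_moment_def P_def Suc by (simp add: power_mult_distrib power_mult[of 2 2] power_mult[of _ 2] del: fact_Suc)
  also have "fact (2 * j + 1) = 4 ^ m * pochhammer (1 / 2) m * (fact j :: complex) / 2"
    by (subst F[symmetric]) simp
  finally have B: "complex_of_real (bose_moment j) = pochhammer (1 / 2) m * fact j / 2 * of_real (zeta_nat (2 * m)) / P"
    by simp
  have "I_coeff z m = 4 / z * exp (- (z ^ 2) / 8) * (z * (- 1) ^ j / fact j * Q) *
      (pochhammer (1 / 2) m * fact j / 2 * of_real (zeta_nat (2 * m)) / P)"
    by (simp only: I_coeff_def Suc nat.case a B[unfolded Suc])
  also have "\<dots> = 2 * exp (- (z ^ 2) / 8) * (- 1) ^ j * Q * pochhammer (1 / 2) m * of_real (zeta_nat (2 * m)) / P"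
    using z by simp
  \<comment> \<open>The sign of the factor -2 comes from (-1)^j = -(-1)^m.\<close>
  also have "\<dots> = - 2 / complex_of_real (sqrt pi) * exp (z ^ 2 / 8) * ((- 1) ^ m / P * of_real (zeta_nat (2 * m)) *
      (pochhammer (1 / 2) m * of_real (sqrt pi)) * (exp (- (z ^ 2) / 4) * Q))"
    unfolding e[symmetric] Suc by simp
  finally show ?thesis
    unfolding K Z Gamma_of_nat_plus_half pow ..
qed

theorem theorem1p4:
  fixes z :: complex
  assumes "z \<noteq> 0"
  shows "(poincare_expansion (at_right 0) quarter_scale (I_fun z)
           (\<lambda>m \<alpha>. - 2 / complex_of_real (sqrt pi) * complex_of_real (\<alpha> powr (- 1 / 4)) * exp (z ^ 2 / 8) *
              (complex_of_real (- \<alpha> / pi ^ 2) ^ m * riemann_zeta (2 * of_nat m) *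
               Gamma (of_nat m + 1 / 2) * kummer_1F1 (of_nat m + 1 / 2) (3 / 2) (- (z ^ 2) / 4)))) \<and>
         (\<exists>c :: nat \<Rightarrow> complex.
           c 0 = complex_of_real (sqrt pi) / z * exp (z ^ 2 / 8) * erf (z / 2) \<and>
           c 1 = exp (- (z ^ 2) / 8) / 6 \<and>
           c 2 = (z ^ 2 - 6) * exp (- (z ^ 2) / 8) / 360 \<and>
           c 3 = (60 - 20 * z ^ 2 + z ^ 4) * exp (- (z ^ 2) / 8) / 15120 \<and>
           poincare_expansion (at_right 0) quarter_scale (I_fun z)
             (\<lambda>m \<alpha>. c m * complex_of_real (\<alpha> powr (real m - 1 / 4))))"
proof (intro conjI exI[of _ "I_coeff z"])
  show "poincare_expansion (at_right 0) quarter_scale (I_fun z)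
     (\<lambda>m \<alpha>. I_coeff z m * complex_of_real (\<alpha> powr (real m - 1 / 4)))"
    by (rule poincare_expansion_I_coeff)
  moreover have "\<forall>\<^sub>F \<alpha> in at_right 0. - 2 / complex_of_real (sqrt pi) * complex_of_real (\<alpha> powr (- 1 / 4)) * exp (z ^ 2 / 8) *
              (complex_of_real (- \<alpha> / pi ^ 2) ^ m * riemann_zeta (2 * of_nat m) *
               Gamma (of_nat m + 1 / 2) * kummer_1F1 (of_nat m + 1 / 2) (3 / 2) (- (z ^ 2) / 4)) =
      I_coeff z m * complex_of_real (\<alpha> powr (real m - 1 / 4))" for m
    \<comment> \<open>Positivity of \<alpha> allows \<alpha>^m to be merged with the fractional
      power.\<close>
    using eventually_at_right_less[of 0]
  proof eventually_elim
    case (elim \<alpha>)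
    have "complex_of_real (- \<alpha> / pi ^ 2) ^ m = of_real (\<alpha> ^ m) * (- 1 / of_real (pi ^ 2)) ^ m"
      by (simp add: power_mult_distrib[symmetric])
    moreover have "\<alpha> powr (real m - 1 / 4) = \<alpha> powr (- 1 / 4) * \<alpha> ^ m"
      using elim by (simp add: powr_realpow[symmetric] powr_add[symmetric])
    ultimately show ?case
      unfolding hypergeometric_term_eq_I_coeff[OF assms, symmetric] by (simp only: of_real_mult mult_ac)
  qed
  ultimately show "poincare_expansion (at_right 0) quarter_scale (I_fun z)
           (\<lambda>m \<alpha>. - 2 / complex_of_real (sqrt pi) * complex_of_real (\<alpha> powr (- 1 / 4)) * exp (z ^ 2 / 8) *
              (complex_of_real (- \<alpha> / pi ^ 2) ^ m * riemann_zeta (2 * of_nat m) *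
               Gamma (of_nat m + 1 / 2) * kummer_1F1 (of_nat m + 1 / 2) (3 / 2) (- (z ^ 2) / 4)))"
    by (subst poincare_expansion_cong)
  \<comment> \<open>With the prefactor 4 and the denominators 1, 6, 120 of the Taylor coefficients,
    these give 6, 360 and 15120.\<close>
  have moments: "bose_moment 0 = 1 / 24" "bose_moment 1 = 1 / 240" "bose_moment 2 = 1 / 504"
    by (simp_all add: bose_moment_def zeta_nat_even fact_numeral power_mult_distrib flip: numeral_2_eq_2)
  have coeffs: "gauss_sinh_coeff z 0 = z" "gauss_sinh_coeff z 1 = z * (z ^ 2 - 6) / 6"
    "gauss_sinh_coeff z 2 = z * (60 - 20 * z ^ 2 + z ^ 4) / 120"
    by (simp_all add: gauss_sinh_coeff_def fact_numeral eval_nat_numeral field_simps)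
  show "I_coeff z 0 = complex_of_real (sqrt pi) / z * exp (z ^ 2 / 8) * erf (z / 2)"
    by (simp add: I_coeff_def)
  show "I_coeff z 1 = exp (- (z ^ 2) / 8) / 6"
    using assms by (simp add: I_coeff_def coeffs moments)
  have "I_coeff z (Suc 1) = (z ^ 2 - 6) * exp (- (z ^ 2) / 8) / 360"
    using assms by (simp only: I_coeff_def nat.case coeffs moments) (simp add: field_simps)
  then show "I_coeff z 2 = (z ^ 2 - 6) * exp (- (z ^ 2) / 8) / 360"
    by (simp add: numeral_2_eq_2)
  have "I_coeff z (Suc 2) = (60 - 20 * z ^ 2 + z ^ 4) * exp (- (z ^ 2) / 8) / 15120"
    using assms by (simp only: I_coeff_def nat.case coeffs moments) (simp add: field_simps)
  then show "I_coeff z 3 = (60 - 20 * z ^ 2 + z ^ 4) * exp (- (z ^ 2) / 8) / 15120"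
    by (simp add: numeral_3_eq_3 numeral_2_eq_2)
qed

end
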